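(* Let $p,q$ be positive integers. There is a map from the set $\mathcal{CM}(\mathcal{S}^{B}_{\mathrm{nc}}(p,q))$ of connected maximal chains of $\mathcal{S}^{B}_{\mathrm{nc}}(p,q)$ onto the set $\mathcal{F}_{(p,q)}$ of minimal transitive factorizations of $\alpha_{p,q}$ such that every element of $\mathcal{F}_{(p,q)}$ has exactly two preimages (a 2-1 map).
   Context: A signed permutation is a permutation $\sigma$ of $\{\pm1,\dots,\pm n\}$ with $\sigma(-i)=-\sigma(i)$; $B_n$ denotes the group of these. Write $[a_1~a_2\dots a_k]=(a_1~a_2\dots a_k~-a_1~-a_2\dots -a_k)$ (a zero cycle) and $((a_1~a_2\dots a_k))=(a_1\dots a_k)(-a_1\dots -a_k)$ (a paired nonzero cycle). The type $B$ transpositions are $\epsilon_i=[i]=(i~-i)$ and $((i~j))$ with $|i|\neq|j|$. The absolute length $\ell(\pi)$ of $\pi\in B_n$ is the least $k$ such that $\pi$ is a product of $k$ type $B$ transpositions, and the absolute order is $\pi\le\sigma$ iff $\ell(\sigma)=\ell(\pi)+\ell(\pi^{-1}\sigma)$. Let $\gamma_{p,q}=[1~2\dots p][p+1\dots p+q]\in B_{p+q}$ and $\mathcal{S}^{B}_{\mathrm{nc}}(p,q)=\{\sigma\in B_{p+q}:\epsilon\le\sigma\le\gamma_{p,q}\}$ with the absolute order ($\epsilon$ the identity); it is graded of rank $p+q$. A paired nonzero cycle $((a_1\dots a_k))$ is connected if $\{a_1,\dots,a_k\}$ meets both $\{\pm1,\dots,\pm p\}$ and $\{\pm(p+1),\dots,\pm(p+q)\}$,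 and disconnected otherwise; zero cycles are disconnected. The connectivity of $\sigma$ is its number of connected paired nonzero cycles. A maximal chain $\epsilon=\pi_0<\pi_1<\dots<\pi_{p+q}=\gamma_{p,q}$ of $\mathcal{S}^{B}_{\mathrm{nc}}(p,q)$ is disconnected if every $\pi_i$ has connectivity $0$, and connected otherwise; $\mathcal{CM}(\mathcal{S}^{B}_{\mathrm{nc}}(p,q))$ is the set of connected maximal chains. Let $\alpha_{p,q}=(1~2\dots p)(p+1\dots p+q)\in\mathcal{S}_{p+q}$. $\mathcal{F}_{(p,q)}$ is the set of $(p+q)$-tuples $(\eta_1,\dots,\eta_{p+q})$ of transpositions of $\mathcal{S}_{p+q}$ with $\eta_1\cdots\eta_{p+q}=\alpha_{p,q}$ and such that $\{\eta_1,\dots,\eta_{p+q}\}$ generates $\mathcal{S}_{p+q}$. *)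

theory Defs
  imports
    "HOL-Combinatorics.Combinatorics"
    "HOL-Algebra.Sym_Groups"
    "HOL-Algebra.Generated_Groups"
begin

text \<open>
  Permutations are functions that fix every point outside the permuted set; products of
  permutations are compositions, so the rightmost factor acts first. The list
  \<open>[a1, ..., ak]\<close> stands for the cycle sending \<open>a1\<close> to \<open>a2\<close>, and so on.
  HOL-Algebra writes \<open>inv'\<close> for the inverse of a function.
\<close>

definition perm_prod :: "('a \<Rightarrow> 'a) list \<Rightarrow> 'a \<Rightarrow> 'a" where
  "perm_prod fs = foldr (\<circ>) fs id"

definition signed_range :: "nat \<Rightarrow> int set" where
  "signed_range n = {i. 1 \<le> \<bar>i\<bar> \<and> \<bar>i\<bar> \<le> int n}"

definition signed_perms :: "nat \<Rightarrow> (int \<Rightarrow> int) set" where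
  "signed_perms n = {\<sigma>. \<sigma> permutes signed_range n \<and> (\<forall>i. \<sigma> (- i) = - \<sigma> i)}"

definition zero_cycle :: "int list \<Rightarrow> int \<Rightarrow> int" where
  "zero_cycle as = cycle_of_list (as @ map uminus as)"

definition paired_cycle :: "int list \<Rightarrow> int \<Rightarrow> int" where
  "paired_cycle as = cycle_of_list as \<circ> cycle_of_list (map uminus as)"

definition transpositions_B :: "nat \<Rightarrow> (int \<Rightarrow> int) set" where
  "transpositions_B n =
     {zero_cycle [i] | i. i \<in> signed_range n} \<union>
     {paired_cycle [i, j] | i j. i \<in> signed_range n \<and> j \<in> signed_range n \<and> \<bar>i\<bar> \<noteq> \<bar>j\<bar>}"

definition abs_length :: "nat \<Rightarrow> (int \<Rightarrow> int) \<Rightarrow> nat" where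
  "abs_length n \<pi> =
     (LEAST k. \<exists>ts. length ts = k \<and> set ts \<subseteq> transpositions_B n \<and> perm_prod ts = \<pi>)"

definition abs_le :: "nat \<Rightarrow> (int \<Rightarrow> int) \<Rightarrow> (int \<Rightarrow> int) \<Rightarrow> bool" where
  "abs_le n \<pi> \<sigma> \<longleftrightarrow> abs_length n \<sigma> = abs_length n \<pi> + abs_length n (inv' \<pi> \<circ> \<sigma>)"

definition abs_less :: "nat \<Rightarrow> (int \<Rightarrow> int) \<Rightarrow> (int \<Rightarrow> int) \<Rightarrow> bool" where
  "abs_less n \<pi> \<sigma> \<longleftrightarrow> abs_le n \<pi> \<sigma> \<and> \<pi> \<noteq> \<sigma>"

definition gamma :: "nat \<Rightarrow> nat \<Rightarrow> int \<Rightarrow> int" where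
  "gamma p q = zero_cycle [1..int p] \<circ> zero_cycle [int p + 1..int p + int q]"

definition S_nc_B :: "nat \<Rightarrow> nat \<Rightarrow> (int \<Rightarrow> int) set" where
  "S_nc_B p q =
     {\<sigma> \<in> signed_perms (p + q). abs_le (p + q) id \<sigma> \<and> abs_le (p + q) \<sigma> (gamma p q)}"

text \<open>
  In a paired nonzero cycle the absolute values of the entries listed are pairwise distinct. Each
  cycle is represented by the permutation \<open>paired_cycle as\<close>, so that the different lists
  denoting one cycle (rotations, and negation of all entries) are identified; it is a cycle of
  \<open>\<sigma>\<close> iff \<open>\<sigma>\<close> agrees with it on the entries.
\<close>

definition connected_cycles :: "nat \<Rightarrow> nat \<Rightarrow> (int \<Rightarrow> int) \<Rightarrow> (int \<Rightarrow> int) set" where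
  "connected_cycles p q \<sigma> =
     {paired_cycle as | as.
        set as \<subseteq> signed_range (p + q) \<and> distinct (map abs as) \<and>
        (\<forall>a\<in>set as. \<sigma> a = paired_cycle as a) \<and>
        set as \<inter> signed_range p \<noteq> {} \<and>
        set as \<inter> (signed_range (p + q) - signed_range p) \<noteq> {}}"

definition connectivity :: "nat \<Rightarrow> nat \<Rightarrow> (int \<Rightarrow> int) \<Rightarrow> nat" where
  "connectivity p q \<sigma> = card (connected_cycles p q \<sigma>)"

text \<open>
  A maximal chain is represented by its set of elements. As the poset is graded of rank
  \<open>p + q\<close> with least element \<open>id\<close> and greatest element \<open>gamma p q\<close>, these
  sets correspond to the sequences from \<open>id\<close> to \<open>gamma p q\<close> with
  \<open>p + q\<close> strict steps.
\<close>

definition maximal_chains :: "nat \<Rightarrow> nat \<Rightarrow> (int \<Rightarrow> int) set set" where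
  "maximal_chains p q = {C. pred_on.maxchain (S_nc_B p q) (abs_less (p + q)) C}"

definition disconnected_chain :: "nat \<Rightarrow> nat \<Rightarrow> (int \<Rightarrow> int) set \<Rightarrow> bool" where
  "disconnected_chain p q C \<longleftrightarrow> (\<forall>\<pi>\<in>C. connectivity p q \<pi> = 0)"

definition CM :: "nat \<Rightarrow> nat \<Rightarrow> (int \<Rightarrow> int) set set" where
  "CM p q = {C \<in> maximal_chains p q. \<not> disconnected_chain p q C}"

definition alpha :: "nat \<Rightarrow> nat \<Rightarrow> nat \<Rightarrow> nat" where
  "alpha p q = cycle_of_list [1..<p + 1] \<circ> cycle_of_list [p + 1..<p + q + 1]"

definition transpositions_A :: "nat \<Rightarrow> (nat \<Rightarrow> nat) set" where
  "transpositions_A n = {transpose i j | i j. i \<in> {1..n} \<and> j \<in> {1..n} \<and> i \<noteq> j}"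

definition min_trans_fact :: "nat \<Rightarrow> nat \<Rightarrow> (nat \<Rightarrow> nat) list set" where
  "min_trans_fact p q =
     {\<eta>s. length \<eta>s = p + q \<and> set \<eta>s \<subseteq> transpositions_A (p + q) \<and>
           perm_prod \<eta>s = alpha p q \<and>
           generate (sym_group (p + q)) (set \<eta>s) = carrier (sym_group (p + q))}"

end

theory Submission
  imports Defs
begin

text \<open>
  Write a signed permutation of \<open>{1..n}\<close>, \<open>n = p + q\<close>, as a pair of a permutation and a set of
  signs. Maximal chains correspond to the words of \<open>n\<close> reflections with product \<open>gamma p q\<close>, and
  forgetting signs turns such a word into a factorization of \<open>alpha p q\<close> by transpositions and
  identities.

  A factorization of \<open>alpha p q\<close> containing a transposition across the two blocks is transitive,
  so it has at least \<open>n - 1\<close> transpositions (a connected graph on \<open>n\<close> vertices), and at least \<open>n\<close>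
  by parity. Hence a connected chain uses no letter \<open>[i]\<close> and its image is a minimal transitive
  factorization. Conversely, take the shortest prefix of a minimal transitive factorization that
  contains a transposition across the blocks. Its product has no shorter factorization, so its
  transpositions form a forest and every choice of signs on it can be gauged away; thus all cycles
  of the corresponding element of the chain are paired, and one of them is connected.

  Finally, the signs of the product of a lift are the boundary modulo 2 of an edge set in a
  connected graph with \<open>n\<close> vertices and \<open>n\<close> edges, whose edges are conjugates of the given
  transpositions. Every even vertex set, in particular the sign set \<open>{1, p + 1}\<close> of \<open>gamma p q\<close>,
  is the boundary of exactly two edge sets.
\<close>

subsection \<open>Factorizations into transpositions\<close>

lemma perm_prod_Nil [simp]: "perm_prod [] = id"
  by (simp add: perm_prod_def)

lemma perm_prod_Cons [simp]: "perm_prod (f # fs) = f \<circ> perm_prod fs"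
  by (simp add: perm_prod_def)

lemma perm_prod_append [simp]: "perm_prod (fs @ gs) = perm_prod fs \<circ> perm_prod gs"
  by (induction fs) (simp_all add: comp_assoc)

lemma perm_prod_permutes: "(\<And>f. f \<in> set fs \<Longrightarrow> f permutes S) \<Longrightarrow> perm_prod fs permutes S"
  by (induction fs) (auto intro: permutes_compose permutes_id)

lemma perm_prod_image_invariant: "(\<And>f. f \<in> set fs \<Longrightarrow> f ` U = U) \<Longrightarrow> perm_prod fs ` U = U"
  by (induction fs) (simp_all add: image_comp [symmetric] del: image_comp comp_apply)

definition moved :: "('a \<Rightarrow> 'a) \<Rightarrow> 'a set" where
  "moved f = {x. f x \<noteq> x}"

lemma moved_transpose: "a \<noteq> b \<Longrightarrow> moved (transpose a b) = {a, b}"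
  by (auto simp: moved_def transpose_def)

text \<open>Graph reading used throughout: a transposition is an edge, and a vertex set is invariant
  under it when it does not cut that edge.\<close>

lemma transpose_image_invariant_iff: "transpose a b ` U = U \<longleftrightarrow> (a \<in> U \<longleftrightarrow> b \<in> U)"
  by (auto simp: transpose_def image_iff split: if_splits)

lemma transpositions_A_E:
  assumes "\<eta> \<in> transpositions_A n"
  obtains a b where "\<eta> = transpose a b" "a \<in> {1..n}" "b \<in> {1..n}" "a \<noteq> b"
  using assms by (auto simp: transpositions_A_def)

lemma transpositions_A_permutes: "\<eta> \<in> transpositions_A n \<Longrightarrow> \<eta> permutes {1..n}"
  by (erule transpositions_A_E) (auto intro: permutes_swap_id)

section \<open>Linear algebra by counting over the field with two elements\<close>

lemma bij_betw_sym_diff: "X \<subseteq> V \<Longrightarrow> bij_betw (sym_diff X) (Pow V) (Pow V)"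
  by (rule bij_betw_byWitness[where f' = "sym_diff X"]) auto

text \<open>Rank-nullity in counting form: \<open>d\<close> is a difference operation,
  \<open>z\<close> the zero value, and translation by \<open>x\<close> carries the fibre through
  \<open>x\<close> onto the kernel. Leaving \<open>d\<close> abstract lets the result serve vertex
  sets under \<open>sym_diff\<close> as well as Boolean lists under
  \<open>map2 (\<noteq>)\<close>.\<close>

lemma
  assumes "finite A"
    and "\<And>x. x \<in> A \<Longrightarrow> bij_betw (d x) A A"
    and "\<And>x y. \<lbrakk>x \<in> A; y \<in> A\<rbrakk> \<Longrightarrow> f (d x y) = z \<longleftrightarrow> f y = f x"
  shows card_fiber_eq_kernel: "x \<in> A \<Longrightarrow> card {y \<in> A. f y = f x} = card {y \<in> A. f y = z}"
    and card_eq_image_times_kernel: "card A = card (f ` A) * card {y \<in> A. f y = z}"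
proof -
  show *: "card {y \<in> A. f y = f x} = card {y \<in> A. f y = z}" if "x \<in> A" for x
  proof (rule bij_betw_same_card[of "d x"])
    show "bij_betw (d x) {y \<in> A. f y = f x} {y \<in> A. f y = z}"
      using assms(2)[OF that] assms(3)[OF that] unfolding bij_betw_def inj_on_def image_iff set_eq_iff
      by (auto simp: image_iff) metis
  qed
  have "card A = (\<Sum>x\<in>A. 1)" by simp
  also have "\<dots> = (\<Sum>w\<in>f ` A. \<Sum>y\<in>{y \<in> A. f y = w}. 1)"
    using assms(1) by (rule sum.image_gen)
  also have "\<dots> = (\<Sum>w\<in>f ` A. card {y \<in> A. f y = z})"
    by (rule sum.cong) (use * in auto)
  finally show "card A = card (f ` A) * card {y \<in> A. f y = z}" by simp
qed

text \<open>The coboundary map of the graph whose edges are the listed transpositions: each entry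
  says whether \<open>U\<close> cuts the corresponding edge.\<close>

definition separations :: "('a \<Rightarrow> 'a) list \<Rightarrow> 'a set \<Rightarrow> bool list" where
  "separations \<eta>s U = map (\<lambda>\<eta>. \<eta> ` U \<noteq> U) \<eta>s"

text \<open>Linearity of the coboundary: a symmetric difference cuts an edge exactly when one of the
  two sets does.\<close>

lemma separations_sym_diff:
  assumes "\<And>\<eta>. \<eta> \<in> set \<eta>s \<Longrightarrow> \<exists>a b. \<eta> = transpose a b"
  shows "separations \<eta>s (sym_diff U W) = map2 (\<noteq>) (separations \<eta>s U) (separations \<eta>s W)"
  using assms unfolding separations_def
proof (induction \<eta>s)
  case (Cons \<eta> \<eta>s)
  obtain a b where "\<eta> = transpose a b" using Cons.prems[of \<eta>] by auto
  then show ?case using Cons by (simp add: transpose_image_invariant_iff) blast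
qed simp

lemma map2_neq_eq_replicate_False:
  "length xs = length ys \<Longrightarrow> map2 (\<noteq>) xs ys = replicate (length xs) False \<longleftrightarrow> ys = xs"
  by (induction xs ys rule: list_induct2) auto

lemma separations_eq_replicate_False:
  "separations \<eta>s U = replicate (length \<eta>s) False \<longleftrightarrow> (\<forall>\<eta>\<in>set \<eta>s. \<eta> ` U = U)"
  by (induction \<eta>s) (auto simp: separations_def)

text \<open>Rank-nullity for the coboundary. The kernel consists of the unions of connected
  components of the graph on \<open>V\<close>.\<close>

lemma card_separations:
  assumes "finite V" "\<And>\<eta>. \<eta> \<in> set \<eta>s \<Longrightarrow> \<exists>a b. \<eta> = transpose a b"
  shows "2 ^ card V = card (separations \<eta>s ` Pow V) * card {U \<in> Pow V. \<forall>\<eta>\<in>set \<eta>s. \<eta> ` U = U}"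
proof -
  have "separations \<eta>s (sym_diff U W) = replicate (length \<eta>s) False \<longleftrightarrow>
      separations \<eta>s W = separations \<eta>s U" for U W
    unfolding separations_sym_diff[of \<eta>s, OF assms(2), simplified]
    using map2_neq_eq_replicate_False[of "separations \<eta>s U" "separations \<eta>s W"]
    by (simp add: separations_def)
  then have "card (Pow V) = card (separations \<eta>s ` Pow V) *
      card {U \<in> Pow V. separations \<eta>s U = replicate (length \<eta>s) False}"
    by (intro card_eq_image_times_kernel[where d = sym_diff])
      (use assms(1) bij_betw_sym_diff in auto)
  then show ?thesis
    by (simp add: card_Pow assms(1) separations_eq_replicate_False)
qed

lemma card_bool_lists: "card {es :: bool list. length es = m} = 2 ^ m"
  and finite_bool_lists: "finite {es :: bool list. length es = m}"
  using card_lists_length_eq[of "UNIV :: bool set" m] finite_lists_length_eq[of "UNIV :: bool set" m]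
  by simp_all

lemma bij_betw_map2_neq:
  "length es = m \<Longrightarrow> bij_betw (map2 (\<noteq>) es) {es :: bool list. length es = m} {es. length es = m}"
proof (rule bij_betw_byWitness[where f' = "map2 (\<noteq>) es"])
  assume l: "length es = m"
  have "map2 (\<noteq>) es (map2 (\<noteq>) es fs) = fs" if "length es = length fs" for fs
    using that by (induction es fs rule: list_induct2) auto
  with l show "\<forall>a\<in>{es. length es = m}. map2 (\<noteq>) es (map2 (\<noteq>) es a) = a"
    and "\<forall>a\<in>{es. length es = m}. map2 (\<noteq>) es (map2 (\<noteq>) es a) = a"
    by simp_all
qed auto

text \<open>If \<open>\<rho>\<close> has \<open>c\<close> cycles, it has \<open>2 ^ c\<close> invariant subsets, so this bounds its length by \<open>n - c\<close>
  without mentioning cycles.\<close>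

lemma permutation_word_bound:
  assumes "\<rho> permutes {1..n}"
  shows "\<exists>zs. set zs \<subseteq> transpositions_A n \<and> perm_prod zs = \<rho> \<and>
    card {U \<in> Pow {1..n}. \<rho> ` U = U} * 2 ^ length zs \<le> 2 ^ n"
  using assms
proof (induction "card (moved \<rho>)" arbitrary: \<rho> rule: less_induct)
  case less
  have fin: "finite (moved \<rho>)"
    by (rule finite_subset[of _ "{1..n}"]) (use less.prems in \<open>auto simp: moved_def permutes_def\<close>)
  show ?case
  proof (cases "moved \<rho> = {}")
    case True
    then have "\<rho> = id" by (auto simp: moved_def)
    moreover have "card {U \<in> Pow {1..n}. id ` U = U} = 2 ^ n"
      by (simp add: card_Pow flip: Pow_def)
    ultimately show ?thesis by (intro exI[of _ "[]"]) simp
  next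
    case False
    then obtain a where a: "\<rho> a \<noteq> a" by (auto simp: moved_def)
    \<comment> \<open>Multiplying by this transposition removes \<open>a\<close> from its cycle and
      makes it a fixed point.\<close>
    define t where "t = transpose a (\<rho> a)"
    have aV: "a \<in> {1..n}" using a less.prems by (meson permutes_not_in)
    then have raV: "\<rho> a \<in> {1..n}" using less.prems by (meson permutes_in_image)
    have t: "t \<in> transpositions_A n"
      using a[symmetric] aV raV unfolding t_def transpositions_A_def by blast
    have tt: "t \<circ> t = id" by (simp add: t_def)
    define \<sigma> where "\<sigma> = t \<circ> \<rho>"
    have \<sigma>: "\<sigma> permutes {1..n}"
      unfolding \<sigma>_def using less.prems transpositions_A_permutes[OF t] by (rule permutes_compose)
    have sa: "\<sigma> a = a" by (simp add: \<sigma>_def t_def)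
    have inj: "\<rho> x = \<rho> y \<longleftrightarrow> x = y" for x y
      using permutes_inj[OF less.prems] by (auto simp: inj_def)
    have "moved \<sigma> \<subset> moved \<rho>"
    proof
      show "moved \<sigma> \<subseteq> moved \<rho>"
        using sa a inj by (auto simp: moved_def \<sigma>_def t_def transpose_def split: if_splits)
      show "moved \<sigma> \<noteq> moved \<rho>" using sa a by (auto simp: moved_def)
    qed
    then have "card (moved \<sigma>) < card (moved \<rho>)" using fin by (rule psubset_card_mono[rotated])
    from less.hyps[OF this \<sigma>] obtain zs where zs: "set zs \<subseteq> transpositions_A n" "perm_prod zs = \<sigma>"
      "card {U \<in> Pow {1..n}. \<sigma> ` U = U} * 2 ^ length zs \<le> 2 ^ n" by blast
    let ?I = "{U \<in> Pow {1..n}. \<rho> ` U = U}" and ?J = "{U \<in> Pow {1..n}. \<sigma> ` U = U}"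
    \<comment> \<open>Membership of the new fixed point \<open>a\<close> is a free choice, so
      \<sigma> has at least twice as many invariant sets as \<rho>. This factor 2 pays for the extra
      letter \<open>t\<close>.\<close>
    let ?f = "\<lambda>(U, e). if e then insert a U else U - {a}"
    have img: "?f ` (?I \<times> (UNIV :: bool set)) \<subseteq> ?J"
    proof (intro image_subsetI, clarify)
      fix U e assume U: "\<rho> ` U = U" "U \<subseteq> {1..n}"
      have "a \<in> U \<longleftrightarrow> \<rho> a \<in> U"
        using arg_cong[OF U(1), of "\<lambda>S. \<rho> a \<in> S"] by (auto simp: image_iff inj)
      then have s: "\<sigma> ` U = U"
        using U(1) unfolding \<sigma>_def t_def image_comp[symmetric] by (simp add: transpose_image_invariant_iff)
      have "\<sigma> ` (U - {a}) = U - {a}"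
        using s sa permutes_inj[OF \<sigma>] by (simp add: image_set_diff)
      then show "(if e then insert a U else U - {a}) \<in> Pow {1..n} \<and>
          \<sigma> ` (if e then insert a U else U - {a}) = (if e then insert a U else U - {a})"
        using s sa U(2) aV by (cases e) (simp_all, blast)
    qed
    have injf: "inj_on ?f (?I \<times> (UNIV :: bool set))"
    proof (rule inj_onI)
      fix X Y assume XY: "X \<in> ?I \<times> (UNIV :: bool set)" "Y \<in> ?I \<times> (UNIV :: bool set)" "?f X = ?f Y"
      obtain U e U' e' where X: "X = (U, e)" and Y: "Y = (U', e')" by (cases X, cases Y) blast
      with XY have U: "\<rho> ` U = U" "\<rho> ` U' = U'" and eq: "?f (U, e) = ?f (U', e')" by simp_all
      \<comment> \<open>Overwriting membership of \<open>a\<close> loses nothing: it can be read off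
        at the other point \<open>\<rho> a\<close> of the same cycle.\<close>
      have *: "a \<in> U \<longleftrightarrow> \<rho> a \<in> U" "a \<in> U' \<longleftrightarrow> \<rho> a \<in> U'"
        using arg_cong[OF U(1), of "\<lambda>S. \<rho> a \<in> S"] arg_cong[OF U(2), of "\<lambda>S. \<rho> a \<in> S"]
        by (auto simp: image_iff inj)
      have "x \<in> U \<longleftrightarrow> x \<in> U'" if "x \<noteq> a" for x
        using arg_cong[OF eq, of "\<lambda>S. x \<in> S"] that by (auto split: if_splits)
      moreover have "e = e'" using arg_cong[OF eq, of "\<lambda>S. a \<in> S"] by (auto split: if_splits)
      moreover have "x \<in> U \<longleftrightarrow> x \<in> U'" for x
        using * a calculation(1) by (cases "x = a") auto
      ultimately show "X = Y" unfolding X Y by blast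
    qed
    have "card ?I * 2 = card (?I \<times> (UNIV :: bool set))" by (simp add: card_cartesian_product)
    also have "\<dots> \<le> card ?J" by (rule card_inj_on_le[OF injf img]) simp
    finally have "card ?I * 2 * 2 ^ length zs \<le> 2 ^ n" using zs(3)
      by (meson mult_le_mono1 order_trans)
    moreover have "perm_prod (t # zs) = \<rho>"
      using zs(2) tt by (simp add: \<sigma>_def flip: comp_assoc)
    ultimately show ?thesis using zs(1) t by (intro exI[of _ "t # zs"]) (simp add: mult.assoc)
  qed
qed

section \<open>Cycles, signs and the permutation \<open>alpha\<close>\<close>

lemma cycle_of_list_nth:
  assumes "distinct cs" "i < length cs"
  shows "cycle_of_list cs (cs ! i) = cs ! (Suc i mod length cs)"
proof -
  have "map (cycle_of_list cs ^^ 1) cs ! i = rotate 1 cs ! i"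
    by (simp only: cyclic_rotation[OF assms(1)])
  with assms(2) show ?thesis by (simp add: nth_rotate1)
qed

lemma sign_cycle_of_list: "distinct cs \<Longrightarrow> sign (cycle_of_list cs) = (-1) ^ (length cs - 1)"
  by (induction cs rule: cycle_of_list.induct)
    (auto simp: sign_compose permutation_swap_id permutation_of_cycle sign_swap_id)

lemma sign_perm_prod_transpositions:
  "set \<eta>s \<subseteq> transpositions_A n \<Longrightarrow> sign (perm_prod \<eta>s) = (-1) ^ length \<eta>s"
proof (induction \<eta>s)
  case (Cons \<eta> \<eta>s)
  have "permutation \<eta>" if "\<eta> \<in> transpositions_A n" for \<eta>
    using transpositions_A_permutes[OF that] by (auto simp: permutation_permutes)
  moreover have "permutation (perm_prod \<eta>s)"
    using perm_prod_permutes[of \<eta>s "{1..n}"] Cons.prems transpositions_A_permutes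
    by (auto simp: permutation_permutes)
  moreover have "sign \<eta> = -1"
    using Cons.prems by (auto simp: transpositions_A_def sign_swap_id)
  ultimately show ?case using Cons by (simp add: sign_compose del: comp_apply)
qed simp

lemma alpha_apply:
  "alpha p q x = (if 1 \<le> x \<and> x \<le> p then if x = p then 1 else x + 1
     else if p < x \<and> x \<le> p + q then if x = p + q then p + 1 else x + 1 else x)"
proof -
  have c: "cycle_of_list [a..<b] x = (if a \<le> x \<and> x < b then if x + 1 = b then a else x + 1 else x)"
    for a b x :: nat
  proof (cases "a \<le> x \<and> x < b")
    case True
    then have x: "[a..<b] ! (x - a) = x" "x - a < length [a..<b]" by auto
    have "cycle_of_list [a..<b] x = [a..<b] ! (Suc (x - a) mod (b - a))"
      using cycle_of_list_nth[OF distinct_upt x(2)] unfolding x(1) by simp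
    also have "\<dots> = (if x + 1 = b then a else x + 1)"
    proof (cases "x + 1 = b")
      case False
      then have "Suc (x - a) < b - a" "a + Suc (x - a) = x + 1" "a + Suc (x - a) < b"
        using True by linarith+
      then have "[a..<b] ! (Suc (x - a) mod (b - a)) = x + 1"
        using nth_upt[of a "Suc (x - a)" b] by (simp only: mod_less)
      then show ?thesis unfolding if_not_P[OF False] .
    next
      case last: True
      then have "Suc (x - a) = b - a" "a + 0 < b" using True by linarith+
      then have "[a..<b] ! (Suc (x - a) mod (b - a)) = a" using nth_upt[of a 0 b] by (simp only: mod_self add_0_right)
      then show ?thesis unfolding if_P[OF last] .
    qed
    finally show ?thesis using True by simp
  next
    case False
    then have "x \<notin> set [a..<b]" by auto
    then show ?thesis using False by (subst id_outside_supp) auto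
  qed
  show ?thesis unfolding alpha_def comp_def c by auto
qed

lemma alpha_permutes: "alpha p q permutes {1..p + q}"
proof -
  have "cycle_of_list [1..<p + 1] permutes {1..p + q}"
    by (rule permutes_subset[OF cycle_permutes]) auto
  moreover have "cycle_of_list [p + 1..<p + q + 1] permutes {1..p + q}"
    by (rule permutes_subset[OF cycle_permutes]) auto
  ultimately show ?thesis unfolding alpha_def by (rule permutes_compose[rotated])
qed

lemma sign_alpha: "p \<ge> 1 \<Longrightarrow> q \<ge> 1 \<Longrightarrow> sign (alpha p q) = (-1) ^ (p + q)"
  unfolding alpha_def
  by (simp add: sign_compose permutation_of_cycle sign_cycle_of_list del: upt_Suc)
    (cases p; cases q; simp add: power_add)

lemma alpha_invariant_subset:
  assumes "alpha p q ` U = U"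
  shows "\<lbrakk>x \<in> U; x \<in> {1..p}\<rbrakk> \<Longrightarrow> {1..p} \<subseteq> U"
    and "\<lbrakk>x \<in> U; x \<in> {p + 1..p + q}\<rbrakk> \<Longrightarrow> {p + 1..p + q} \<subseteq> U"
proof -
  have step: "alpha p q y \<in> U" if "y \<in> U" for y using assms that by blast
  \<comment> \<open>Walk from \<open>x\<close> to the last point of its block, wrap around to the
    first point, and walk up again: an invariant set that meets a block contains it.\<close>
  have up: "x \<in> U \<Longrightarrow> (x + k \<in> U)"
    if "1 \<le> x" "x + k \<le> p \<or> p < x \<and> x + k \<le> p + q" for x k
    using that
  proof (induction k)
    case (Suc k)
    then show ?case using step[of "x + k"] by (auto simp: alpha_apply split: if_splits)
  qed simp
  show "{1..p} \<subseteq> U" if "x \<in> U" "x \<in> {1..p}"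
  proof
    fix y assume y: "y \<in> {1..p}"
    have "p \<in> U" using up[of x "p - x"] that by simp
    then have "1 \<in> U" using step[of p] that by (simp add: alpha_apply split: if_splits)
    then show "y \<in> U" using up[of 1 "y - 1"] y by simp
  qed
  show "{p + 1..p + q} \<subseteq> U" if "x \<in> U" "x \<in> {p + 1..p + q}"
  proof
    fix y assume y: "y \<in> {p + 1..p + q}"
    have "p + q \<in> U" using up[of x "p + q - x"] that by simp
    then have "p + 1 \<in> U" using step[of "p + q"] that by (simp add: alpha_apply split: if_splits)
    moreover have "p + 1 + (y - (p + 1)) = y" using y by simp
    ultimately show "y \<in> U" using up[of "p + 1" "y - (p + 1)"] y by (simp only: atLeastAtMost_iff) simp
  qed
qed

section \<open>Transitivity, connectedness and generation\<close>

definition transitive_on :: "nat \<Rightarrow> (nat \<Rightarrow> nat) list \<Rightarrow> bool" where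
  "transitive_on n \<eta>s \<longleftrightarrow> (\<forall>U\<subseteq>{1..n}. (\<forall>\<eta>\<in>set \<eta>s. \<eta> ` U = U) \<longrightarrow> U = {} \<or> U = {1..n})"

text \<open>A set invariant under all letters is invariant under their product, hence a union of
  blocks inside \<open>{1..p + q}\<close>; the crossing letter forces both blocks or
  neither.\<close>

lemma crossing_factorization_transitive:
  assumes "set \<eta>s \<subseteq> transpositions_A (p + q)" "perm_prod \<eta>s = alpha p q"
    and "\<eta> \<in> set \<eta>s" "\<eta> ` {1..p} \<noteq> {1..p}"
  shows "transitive_on (p + q) \<eta>s"
  unfolding transitive_on_def
proof (intro allI impI)
  fix U assume U: "U \<subseteq> {1..p + q}" "\<forall>\<eta>\<in>set \<eta>s. \<eta> ` U = U"
  then have "alpha p q ` U = U" using perm_prod_image_invariant[of \<eta>s U] assms(2) by simp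
  note aU = alpha_invariant_subset[OF this]
  obtain a b where ab: "\<eta> = transpose a b" "a \<in> {1..p + q}" "b \<in> {1..p + q}"
    using assms(1,3) by (meson subsetD transpositions_A_E)
  have "a \<in> {1..p} \<longleftrightarrow> b \<notin> {1..p}"
    using assms(4) unfolding ab(1) transpose_image_invariant_iff by blast
  moreover have "a \<in> U \<longleftrightarrow> b \<in> U" using U(2) assms(3) ab(1) transpose_image_invariant_iff by metis
  moreover have split: "{1..p + q} = {1..p} \<union> {p + 1..p + q}" by auto
  ultimately obtain c d where cd: "c \<in> {1..p}" "d \<in> {p + 1..p + q}" "c \<in> U \<longleftrightarrow> d \<in> U"
    using ab(2,3) that[of a b] that[of b a] by blast
  show "U = {} \<or> U = {1..p + q}"
  proof (cases "c \<in> U")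
    case True
    then have "{1..p} \<subseteq> U" "{p + 1..p + q} \<subseteq> U" using aU(1)[OF True cd(1)] aU(2) cd by auto
    then show ?thesis using U(1) split by auto
  next
    case False
    have "x \<notin> U" for x
    proof
      assume x: "x \<in> U"
      then have "x \<in> {1..p} \<or> x \<in> {p + 1..p + q}" using U(1) split by blast
      with aU[OF x] have "{1..p} \<subseteq> U \<or> {p + 1..p + q} \<subseteq> U" by argo
      then show False using False cd by auto
    qed
    then show ?thesis by blast
  qed
qed

text \<open>The edge bound for connected graphs: the coboundary has at most two sets in its kernel
  and at most \<open>2 ^ length \<eta>s\<close> values, while there are \<open>2 ^ n\<close> vertex
  sets.\<close>

lemma transitive_length:
  assumes "set \<eta>s \<subseteq> transpositions_A n" "transitive_on n \<eta>s"
  shows "n \<le> Suc (length \<eta>s)"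
proof -
  have *: "separations \<eta>s ` Pow {1..n} \<subseteq> {es. length es = length \<eta>s}"
    by (auto simp: separations_def)
  have "card (separations \<eta>s ` Pow {1..n}) \<le> 2 ^ length \<eta>s"
    using card_mono[OF finite_bool_lists *] by (simp add: card_bool_lists)
  moreover have "card {U \<in> Pow {1..n}. \<forall>\<eta>\<in>set \<eta>s. \<eta> ` U = U} \<le> 2"
  proof -
    have "card {U \<in> Pow {1..n}. \<forall>\<eta>\<in>set \<eta>s. \<eta> ` U = U} \<le> card {{}, {1..n}}"
      by (rule card_mono) (use assms(2) in \<open>auto simp: transitive_on_def\<close>)
    also have "\<dots> \<le> 2" by (simp add: card_insert_if)
    finally show ?thesis .
  qed
  moreover have "2 ^ card {1..n} = card (separations \<eta>s ` Pow {1..n}) * card {U \<in> Pow {1..n}. \<forall>\<eta>\<in>set \<eta>s. \<eta> ` U = U}"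
    by (rule card_separations) (use assms(1) in \<open>auto elim!: transpositions_A_E dest!: subsetD\<close>)
  ultimately have "2 ^ card {1..n} \<le> (2 ^ length \<eta>s * 2 :: nat)"
    by (simp only: mult_le_mono)
  then have "2 ^ n \<le> (2 ^ Suc (length \<eta>s) :: nat)" by (simp add: mult.commute)
  then show ?thesis by (subst (asm) power_increasing_iff) auto
qed

lemma crossing_factorization_length:
  assumes "p \<ge> 1" "q \<ge> 1"
    and "set \<eta>s \<subseteq> transpositions_A (p + q)" "perm_prod \<eta>s = alpha p q"
    and "\<eta> \<in> set \<eta>s" "\<eta> ` {1..p} \<noteq> {1..p}"
  shows "p + q \<le> length \<eta>s"
proof -
  have "p + q \<le> Suc (length \<eta>s)"
    using transitive_length crossing_factorization_transitive assms(3-) by blast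
  \<comment> \<open>Since \<open>alpha p q\<close> is a product of two disjoint cycles covering all
    points, its sign is \<open>(-1) ^ (p + q)\<close>, and a word with one letter less has the wrong
    parity.\<close>
  moreover have "(-1 :: int) ^ length \<eta>s = (-1) ^ (p + q)"
    using sign_perm_prod_transpositions[OF assms(3)] sign_alpha[OF assms(1,2)] assms(4) by simp
  then have "p + q \<noteq> Suc (length \<eta>s)" by (cases "even (length \<eta>s)") auto
  ultimately show ?thesis by simp
qed

text \<open>Replaces the group-theoretic condition on factorizations by connectedness of the graph
  of the letters, the form in which it can be counted.\<close>

lemma generate_eq_sym_group_iff:
  assumes "set \<eta>s \<subseteq> transpositions_A n"
  shows "generate (sym_group n) (set \<eta>s) = carrier (sym_group n) \<longleftrightarrow> transitive_on n \<eta>s"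
    (is "?G = _ \<longleftrightarrow> _")
proof
  interpret group "sym_group n" by (rule sym_group_is_group)
  have sub: "set \<eta>s \<subseteq> carrier (sym_group n)"
    using assms transpositions_A_permutes by (auto simp: sym_group_carrier)
  {
    assume G: "?G = carrier (sym_group n)"
    show "transitive_on n \<eta>s" unfolding transitive_on_def
    proof (intro allI impI)
      fix U assume U: "U \<subseteq> {1..n}" "\<forall>\<eta>\<in>set \<eta>s. \<eta> ` U = U"
      have inv: "h ` U = U" if "h \<in> ?G" for h
        using that
      proof induction
        case (inv h)
        then have "h permutes {1..n}" using sub by (auto simp: sym_group_carrier)
        then have "inv' h ` h ` U = U" by (simp add: image_comp permutes_inv_o)
        moreover have "inv\<^bsub>sym_group n\<^esub> h = inv' h" using inv sub by auto
        ultimately show ?case using inv U(2) by simp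
      next
        case (eng h1 h2)
        then show ?case unfolding sym_group_mult image_comp[symmetric] by simp
      qed (use U in \<open>auto simp: sym_group_one\<close>)
      show "U = {} \<or> U = {1..n}"
      proof (rule ccontr)
        assume "\<not> ?thesis"
        then obtain x y where xy: "x \<in> U" "y \<in> {1..n}" "y \<notin> U" using U(1) by blast
        then have "transpose x y \<in> ?G"
          unfolding G sym_group_carrier using U(1) by (intro permutes_swap_id) auto
        then show False using inv xy transpose_image_invariant_iff by metis
      qed
    qed
  next
    assume T: "transitive_on n \<eta>s"
    have mem: "\<eta> \<in> ?G" if "\<eta> \<in> set \<eta>s" for \<eta> using that by (rule generate.incl)
    have mult: "g \<circ> h \<in> ?G" if "g \<in> ?G" "h \<in> ?G" for g h
      using generate.eng[OF that] by (simp add: sym_group_mult)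
    have all: "transpose x y \<in> ?G" if xy: "x \<in> {1..n}" "y \<in> {1..n}" "x \<noteq> y" for x y
    proof -
      \<comment> \<open>The points exchanged with \<open>x\<close> by a transposition in the
        generated group. Conjugating \<open>(x a)\<close> by \<open>(a b)\<close> gives
        \<open>(x b)\<close>, so the set is closed under edges and transitivity makes it
        everything.\<close>
      define U where "U = {y \<in> {1..n}. y = x \<or> transpose x y \<in> ?G}"
      have step: "b \<in> U" if "a \<in> U" "transpose a b \<in> ?G" "b \<in> {1..n}" for a b
      proof -
        have a: "a = x \<or> transpose x a \<in> ?G" using that(1) by (simp add: U_def)
        have "x = b \<or> transpose x b \<in> ?G"
        proof (cases "x = a \<or> x = b \<or> a = b")
          case True
          then show ?thesis using a that(2) by metis
        next
          case False
          then have "transpose x b = transpose a b \<circ> transpose x a \<circ> transpose a b"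
            by (auto simp: transpose_def fun_eq_iff)
          moreover have "transpose a b \<circ> transpose x a \<circ> transpose a b \<in> ?G"
            using a False that(2) by (intro mult) auto
          ultimately show ?thesis by simp
        qed
        then show ?thesis using that(3) by (auto simp: U_def)
      qed
      have "\<eta> ` U = U" if \<eta>: "\<eta> \<in> set \<eta>s" for \<eta>
      proof -
        obtain a b where ab: "\<eta> = transpose a b" "a \<in> {1..n}" "b \<in> {1..n}" "a \<noteq> b"
          using assms \<eta> by (meson subsetD transpositions_A_E)
        then show ?thesis using step[of a b] step[of b a] mem[OF \<eta>]
          unfolding ab(1) transpose_image_invariant_iff by (metis transpose_commute)
      qed
      moreover have "x \<in> U" "U \<subseteq> {1..n}" using xy by (auto simp: U_def)
      ultimately have "U = {1..n}" using T unfolding transitive_on_def by blast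
      then show ?thesis using xy by (auto simp: U_def)
    qed
    show "?G = carrier (sym_group n)"
    proof
      show "?G \<subseteq> carrier (sym_group n)" using sub by (rule generate_incl)
      show "carrier (sym_group n) \<subseteq> ?G"
      proof
        fix \<rho> assume "\<rho> \<in> carrier (sym_group n)"
        then obtain zs where zs: "set zs \<subseteq> transpositions_A n" "perm_prod zs = \<rho>"
          using permutation_word_bound by (metis sym_group_carrier)
        have "perm_prod zs \<in> ?G" using zs(1)
        proof (induction zs)
          case Nil
          then show ?case using generate.one[of "sym_group n" "set \<eta>s"]
            by (simp only: sym_group_one perm_prod_Nil)
        next
          case (Cons z zs)
          then have "z \<in> ?G" using all by (auto simp: transpositions_A_def)
          with Cons show ?case unfolding perm_prod_Cons by (intro mult) simp_all
        qed
        then show "\<rho> \<in> ?G" using zs(2) by simp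
      qed
    qed
  }
qed

subsection \<open>Signed permutations and lifts\<close>

text \<open>The set \<open>N\<close> collects the absolute values of the images whose sign is changed.\<close>

definition signed_of :: "(nat \<Rightarrow> nat) \<Rightarrow> nat set \<Rightarrow> int \<Rightarrow> int" where
  "signed_of \<rho> N x = sgn x * int (\<rho> (nat \<bar>x\<bar>)) * (if \<rho> (nat \<bar>x\<bar>) \<in> N then -1 else 1)"

lemma permutes_0: "\<rho> permutes {1..n} \<Longrightarrow> \<rho> (0 :: nat) = 0"
  by (simp add: permutes_def)

lemma permutes_eq_0_iff: "\<rho> permutes {1..n} \<Longrightarrow> \<rho> x = 0 \<longleftrightarrow> x = (0 :: nat)"
  by (metis permutes_0 permutes_inj injD)

lemma signed_of_uminus: "signed_of \<rho> N (- x) = - signed_of \<rho> N x"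
  by (simp add: signed_of_def sgn_minus)

lemma abs_signed_of: "\<rho> permutes {1..n} \<Longrightarrow> nat \<bar>signed_of \<rho> N x\<bar> = \<rho> (nat \<bar>x\<bar>)"
  by (cases "x = 0") (simp_all add: signed_of_def abs_mult abs_sgn_eq permutes_0[of \<rho> n])

lemma sgn_signed_of:
  "\<rho> permutes {1..n} \<Longrightarrow> sgn (signed_of \<rho> N x) = sgn x * (if \<rho> (nat \<bar>x\<bar>) \<in> N then -1 else 1)"
  by (cases "x = 0") (simp_all add: signed_of_def sgn_mult permutes_eq_0_iff[of \<rho> n] flip: neq0_conv)

text \<open>The semidirect product law of the hyperoctahedral group. As sign sets refer to images,
  the inner one is transported by \<rho>, and signs add modulo 2.\<close>

lemma signed_of_comp:
  assumes "\<rho> permutes {1..n}" "\<sigma> permutes {1..n}"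
  shows "signed_of \<rho> N \<circ> signed_of \<sigma> M = signed_of (\<rho> \<circ> \<sigma>) (sym_diff N (\<rho> ` M))"
proof
  fix x
  have "\<rho> y \<in> \<rho> ` M \<longleftrightarrow> y \<in> M" for y
    using permutes_inj[OF assms(1)] by (auto simp: inj_def)
  then show "(signed_of \<rho> N \<circ> signed_of \<sigma> M) x = signed_of (\<rho> \<circ> \<sigma>) (sym_diff N (\<rho> ` M)) x"
    unfolding comp_apply signed_of_def[of \<rho>] signed_of_def[of "\<lambda>x. \<rho> (\<sigma> x)"] abs_signed_of[OF assms(2)]
      sgn_signed_of[OF assms(2)] by auto
qed

lemma signed_of_id: "signed_of id {} = id"
  by (auto simp: signed_of_def fun_eq_iff sgn_if)

lemma signed_of_eq_iff:
  assumes "\<rho> permutes {1..n}" "\<sigma> permutes {1..n}" "N \<subseteq> {1..n}" "M \<subseteq> {1..n}"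
  shows "signed_of \<rho> N = signed_of \<sigma> M \<longleftrightarrow> \<rho> = \<sigma> \<and> N = M"
proof
  assume eq: "signed_of \<rho> N = signed_of \<sigma> M"
  have "\<rho> x = \<sigma> x" for x
    using arg_cong[OF fun_cong[OF eq, of "int x"], of "\<lambda>y. nat \<bar>y\<bar>"]
    by (simp only: abs_signed_of[OF assms(1)] abs_signed_of[OF assms(2)]) simp
  then have \<rho>: "\<rho> = \<sigma>" by auto
  have "y \<in> N \<longleftrightarrow> y \<in> M" if y: "y \<in> {1..n}" for y
  proof -
    obtain x where x: "y = \<rho> x" using permutes_surj[OF assms(1)] by (metis surjD)
    then have "x \<noteq> 0" using y permutes_0[OF assms(1)] by (metis atLeastAtMost_iff not_one_le_zero)
    then show ?thesis
      using arg_cong[OF fun_cong[OF eq, of "int x"], of sgn] unfolding sgn_signed_of[OF assms(1)]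
        sgn_signed_of[OF assms(2)] using x \<rho> by (auto split: if_splits)
  qed
  then show "\<rho> = \<sigma> \<and> N = M" using \<rho> assms(3,4) by blast
qed simp

lemma signed_range_iff: "x \<in> signed_range n \<longleftrightarrow> nat \<bar>x\<bar> \<in> {1..n}"
  by (auto simp: signed_range_def)

lemma finite_signed_range: "finite (signed_range n)"
  by (rule finite_subset[of _ "{- int n..int n}"]) (auto simp: signed_range_def)

lemma signed_of_in_signed_perms:
  assumes "\<rho> permutes {1..n}" "N \<subseteq> {1..n}"
  shows "signed_of \<rho> N \<in> signed_perms n"
proof -
  have inj: "inj_on (signed_of \<rho> N) (signed_range n)"
  proof (rule inj_onI)
    fix x y assume xy: "signed_of \<rho> N x = signed_of \<rho> N y"
    then have "\<rho> (nat \<bar>x\<bar>) = \<rho> (nat \<bar>y\<bar>)" by (metis abs_signed_of[OF assms(1)])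
    then have a: "nat \<bar>x\<bar> = nat \<bar>y\<bar>" using permutes_inj[OF assms(1)] by (simp add: inj_eq)
    then have "sgn x = sgn y"
      using arg_cong[OF xy, of sgn] unfolding sgn_signed_of[OF assms(1)] by (auto split: if_splits)
    moreover have "\<bar>x\<bar> = \<bar>y\<bar>" using a by (simp add: eq_nat_nat_iff)
    ultimately have "sgn x * \<bar>x\<bar> = sgn y * \<bar>y\<bar>" by simp
    then show "x = y" by (simp add: sgn_mult_abs)
  qed
  have "signed_of \<rho> N ` signed_range n \<subseteq> signed_range n"
    by (simp add: image_subset_iff signed_range_iff abs_signed_of[OF assms(1)]
      permutes_in_image[OF assms(1)] del: atLeastAtMost_iff One_nat_def)
  then have "bij_betw (signed_of \<rho> N) (signed_range n) (signed_range n)"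
    using inj by (simp add: bij_betw_def endo_inj_surj finite_signed_range)
  moreover have "signed_of \<rho> N x = x" if "x \<notin> signed_range n" for x
  proof -
    have "nat \<bar>x\<bar> \<notin> {1..n}" using that by (simp only: signed_range_iff not_False_eq_True)
    then have "\<rho> (nat \<bar>x\<bar>) = nat \<bar>x\<bar>" "nat \<bar>x\<bar> \<notin> N"
      using assms(2) permutes_not_in[OF assms(1)] by blast+
    then show ?thesis by (simp add: signed_of_def sgn_mult_abs)
  qed
  ultimately have "signed_of \<rho> N permutes signed_range n" by (rule bij_imp_permutes)
  then show ?thesis by (simp add: signed_perms_def signed_of_uminus)
qed

text \<open>Existence of the coordinates whose uniqueness is \<open>signed_of_eq_iff\<close>: take
  absolute values for \<rho>, and let \<open>N\<close> collect the absolute values of the negative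
  images of positive points.\<close>

lemma signed_perms_E:
  assumes "\<pi> \<in> signed_perms n"
  obtains \<rho> N where "\<rho> permutes {1..n}" "N \<subseteq> {1..n}" "\<pi> = signed_of \<rho> N"
proof
  define \<rho> where "\<rho> = (\<lambda>i. nat \<bar>\<pi> (int i)\<bar>)"
  define N where "N = {y \<in> {1..n}. \<exists>i\<in>{1..n}. \<rho> i = y \<and> \<pi> (int i) < 0}"
  have p: "\<pi> permutes signed_range n" and odd: "\<pi> (- x) = - \<pi> x" for x
    using assms by (auto simp: signed_perms_def)
  have \<pi>_abs: "\<bar>\<pi> x\<bar> = \<bar>\<pi> \<bar>x\<bar>\<bar>" for x using odd[of x] by (cases "x < 0") auto
  have inj: "inj_on \<rho> {1..n}"
  proof (rule inj_onI)
    fix i j assume ij: "i \<in> {1..n}" "j \<in> {1..n}" "\<rho> i = \<rho> j"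
    then have "\<pi> (int i) = \<pi> (int j) \<or> \<pi> (int i) = \<pi> (- int j)"
      unfolding odd by (auto simp: \<rho>_def abs_eq_iff nat_eq_iff split: if_splits)
    then show "i = j" using permutes_inj[OF p] ij by (auto simp: inj_eq)
  qed
  have "\<rho> ` {1..n} \<subseteq> {1..n}"
  proof
    fix y assume "y \<in> \<rho> ` {1..n}"
    then obtain i where "i \<in> {1..n}" "y = \<rho> i" by blast
    then have "\<pi> (int i) \<in> signed_range n" using permutes_in_image[OF p] by (simp add: signed_range_def)
    then show "y \<in> {1..n}" using \<open>y = \<rho> i\<close> by (simp add: \<rho>_def signed_range_iff)
  qed
  then have "bij_betw \<rho> {1..n} {1..n}" using inj by (simp add: bij_betw_def endo_inj_surj)
  moreover have "\<rho> i = i" if "i \<notin> {1..n}" for i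
    using that permutes_not_in[OF p, of "int i"] by (simp add: \<rho>_def signed_range_iff)
  ultimately show \<rho>: "\<rho> permutes {1..n}" by (rule bij_imp_permutes)
  show "N \<subseteq> {1..n}" by (auto simp: N_def)
  show "\<pi> = signed_of \<rho> N"
  proof
    have pos: "\<pi> (int i) = signed_of \<rho> N (int i)" for i
    proof (cases "i \<in> {1..n}")
      case True
      then have "\<rho> i \<in> {1..n}" using permutes_in_image[OF \<rho>] by blast
      moreover have "\<rho> i \<in> N \<longleftrightarrow> \<pi> (int i) < 0"
      proof
        assume "\<rho> i \<in> N"
        then obtain j where "j \<in> {1..n}" "\<rho> j = \<rho> i" "\<pi> (int j) < 0" by (auto simp: N_def)
        then show "\<pi> (int i) < 0" using inj True by (metis inj_onD)
      qed (use True \<open>\<rho> i \<in> {1..n}\<close> in \<open>unfold N_def, blast\<close>)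
      moreover have "signed_of \<rho> N (int i) = int (\<rho> i) * (if \<rho> i \<in> N then -1 else 1)"
        using True by (simp add: signed_of_def)
      ultimately show ?thesis by (simp add: \<rho>_def)
    next
      case False
      then have "int i \<notin> signed_range n" by (simp add: signed_range_iff)
      moreover have "signed_of \<rho> N permutes signed_range n"
        using signed_of_in_signed_perms[OF \<rho> \<open>N \<subseteq> _\<close>] by (simp add: signed_perms_def)
      ultimately show ?thesis using permutes_not_in[OF p] permutes_not_in by metis
    qed
    show "\<pi> x = signed_of \<rho> N x" for x
    proof (cases "x \<ge> 0")
      case True
      then show ?thesis using pos[of "nat x"] by simp
    next
      case False
      then show ?thesis using pos[of "nat (- x)"] odd[of x] signed_of_uminus[of \<rho> N x] by simp
    qed
  qed
qed

text \<open>The two reflections above a transposition \<open>(a b)\<close>: \<open>False\<close>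
  gives \<open>((a b))\<close> and \<open>True\<close> gives \<open>((a -b))\<close>, which changes
  the sign of both images.\<close>

definition lift :: "bool \<Rightarrow> (nat \<Rightarrow> nat) \<Rightarrow> int \<Rightarrow> int" where
  "lift e \<eta> = signed_of \<eta> (if e then moved \<eta> else {})"

text \<open>The sign set of a lifted word, by the product law \<open>signed_of_comp\<close>.
  Unfolded, it is the sum modulo 2, over the positions with entry \<open>True\<close>, of the moved
  pair of that letter transported by the product of the preceding letters.\<close>

fun boundary :: "bool list \<Rightarrow> ('a \<Rightarrow> 'a) list \<Rightarrow> 'a set" where
  "boundary (e # es) (\<eta> # \<eta>s) = sym_diff (if e then moved \<eta> else {}) (\<eta> ` boundary es \<eta>s)"
| "boundary _ _ = {}"

lemma moved_subset: "\<eta> permutes V \<Longrightarrow> moved \<eta> \<subseteq> V"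
  by (auto simp: moved_def permutes_def)

lemma perm_prod_map2_lift:
  assumes "length es = length \<eta>s" "\<And>\<eta>. \<eta> \<in> set \<eta>s \<Longrightarrow> \<eta> permutes {1..n}"
  shows "perm_prod (map2 lift es \<eta>s) = signed_of (perm_prod \<eta>s) (boundary es \<eta>s)"
  using assms
proof (induction es \<eta>s rule: list_induct2)
  case (Cons e es \<eta> \<eta>s)
  then have "perm_prod \<eta>s permutes {1..n}" by (intro perm_prod_permutes) simp
  with Cons show ?case by (simp add: lift_def signed_of_comp[of \<eta> n] del: comp_apply)
qed (simp add: signed_of_id)

lemma boundary_subset:
  "(\<And>\<eta>. \<eta> \<in> set \<eta>s \<Longrightarrow> \<eta> permutes V) \<Longrightarrow> boundary es \<eta>s \<subseteq> V"
proof (induction es \<eta>s rule: boundary.induct)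
  case (1 e es \<eta> \<eta>s)
  have \<eta>: "\<eta> permutes V" using "1.prems" by simp
  have "boundary es \<eta>s \<subseteq> V" by (rule "1.IH") (use "1.prems" in simp)
  then have "\<eta> ` boundary es \<eta>s \<subseteq> V"
    using permutes_in_image[OF \<eta>] by (auto simp: subset_iff)
  with moved_subset[OF \<eta>] show ?case by auto
qed simp_all

text \<open>Linearity in the choice of signs, because images under injective maps commute with
  symmetric differences.\<close>

lemma boundary_map2_neq:
  assumes "length es = length fs" "length fs = length \<eta>s" "\<And>\<eta>. \<eta> \<in> set \<eta>s \<Longrightarrow> inj \<eta>"
  shows "boundary (map2 (\<noteq>) es fs) \<eta>s = sym_diff (boundary es \<eta>s) (boundary fs \<eta>s)"
  using assms
proof (induction es fs \<eta>s rule: list_induct3)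
  case (Cons e es f fs \<eta> \<eta>s)
  then have "\<eta> ` sym_diff (boundary es \<eta>s) (boundary fs \<eta>s) =
      sym_diff (\<eta> ` boundary es \<eta>s) (\<eta> ` boundary fs \<eta>s)"
    by (simp add: image_Un image_set_diff)
  with Cons show ?case by (cases e; cases f) (simp_all, blast+)
qed simp

lemma boundary_replicate_False: "boundary (replicate k False) \<eta>s = {}"
proof (induction k arbitrary: \<eta>s)
  case (Suc k)
  then show ?case by (cases \<eta>s) auto
qed simp

lemma even_card_sym_diff:
  assumes "finite A" "finite B"
  shows "even (card (sym_diff A B)) \<longleftrightarrow> (even (card A) \<longleftrightarrow> even (card B))"
proof -
  have "card (sym_diff A B) = card (A - B) + card (B - A)"
    using assms by (intro card_Un_disjoint) auto
  moreover have "card A = card (A - B) + card (A \<inter> B)" "card B = card (B - A) + card (A \<inter> B)"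
    using assms card_Int_Diff[of A B] card_Int_Diff[of B A] by (auto simp: Int_commute)
  ultimately show ?thesis by presburger
qed

text \<open>Every selected edge contributes two endpoints, permutations preserve cardinalities, and
  symmetric differences add parities.\<close>

lemma even_card_boundary:
  "set \<eta>s \<subseteq> transpositions_A n \<Longrightarrow> even (card (boundary es \<eta>s))"
proof (induction es \<eta>s rule: boundary.induct)
  case (1 e es \<eta> \<eta>s)
  have \<eta>: "\<eta> \<in> transpositions_A n" and \<eta>s: "set \<eta>s \<subseteq> transpositions_A n" using "1.prems" by auto
  have "finite (boundary es \<eta>s)"
    by (rule finite_subset[OF boundary_subset[of \<eta>s "{1..n}"]]) (use \<eta>s transpositions_A_permutes in auto)
  moreover have "card (moved \<eta>) = 2" "finite (moved \<eta>)"
    using \<eta> by (auto elim!: transpositions_A_E simp: moved_transpose)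
  moreover have "card (\<eta> ` boundary es \<eta>s) = card (boundary es \<eta>s)"
    using permutes_inj[OF transpositions_A_permutes[OF \<eta>]] by (intro card_image) (auto simp: inj_def inj_on_def)
  ultimately show ?case using "1.IH"[OF \<eta>s] by (simp add: even_card_sym_diff)
qed simp_all

text \<open>The \<open>i\<close>-th edge contributing to the boundary is the conjugate of \<open>\<eta>\<^sub>i\<close> by \<open>\<eta>\<^sub>1 \<cdots> \<eta>\<^bsub>i-1\<^esub>\<close>. The
  conjugated transpositions generate the same group as the original ones, so their graph is again
  connected.\<close>

lemma boundary_pairs_separate:
  assumes "set \<eta>s \<subseteq> transpositions_A n"
    and "\<And>x y es. length es = length \<eta>s \<Longrightarrow> boundary es \<eta>s = {x, y} \<Longrightarrow> x \<in> U \<longleftrightarrow> y \<in> U"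
    and "\<eta> \<in> set \<eta>s"
  shows "\<eta> ` U = U"
  using assms
proof (induction \<eta>s arbitrary: U \<eta>)
  case (Cons \<kappa> \<eta>s)
  obtain a b where ab: "\<kappa> = transpose a b" "a \<noteq> b"
    using Cons.prems(1) by (auto simp: transpositions_A_def)
  \<comment> \<open>Selecting the first edge alone yields its two endpoints, so \<open>U\<close>
    does not cut \<kappa>.\<close>
  have "boundary (True # replicate (length \<eta>s) False) (\<kappa> # \<eta>s) = {a, b}"
    by (simp add: boundary_replicate_False ab moved_transpose)
  from Cons.prems(2)[OF _ this] have \<kappa>: "\<kappa> ` U = U"
    unfolding ab(1) transpose_image_invariant_iff by simp
  show ?case
  proof (cases "\<eta> = \<kappa>")
    case False
    have "x \<in> U \<longleftrightarrow> y \<in> U" if "length es = length \<eta>s" "boundary es \<eta>s = {x, y}" for x y es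
    proof -
      \<comment> \<open>Prepending \<open>False\<close> transports the boundary by \<kappa>; as
        \<open>U\<close> is \<kappa>-invariant, the hypothesis passes to the remaining
        letters.\<close>
      have "\<kappa> x \<in> U \<longleftrightarrow> \<kappa> y \<in> U"
        using Cons.prems(2)[of "False # es" "\<kappa> x" "\<kappa> y"] that by simp
      moreover have "\<kappa> z \<in> U \<longleftrightarrow> z \<in> U" for z
        using \<kappa> unfolding ab(1) transpose_image_invariant_iff by (simp add: transpose_def)
      ultimately show ?thesis by blast
    qed
    with Cons.IH[of U \<eta>] Cons.prems(1,3) False show ?thesis by auto
  qed (use \<kappa> in simp)
qed simp

text \<open>In a connected graph every pair of vertices is the boundary of an edge set, and every
  even set is a sum of disjoint pairs.\<close>

lemma boundary_image:
  assumes "set \<eta>s \<subseteq> transpositions_A n" "transitive_on n \<eta>s"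
  shows "(\<lambda>es. boundary es \<eta>s) ` {es. length es = length \<eta>s} = {W. W \<subseteq> {1..n} \<and> even (card W)}"
    (is "?f ` ?E = ?W")
proof
  have perm: "\<eta> permutes {1..n}" if "\<eta> \<in> set \<eta>s" for \<eta>
    using assms(1) transpositions_A_permutes that by blast
  show "?f ` ?E \<subseteq> ?W"
    using boundary_subset[of \<eta>s "{1..n}", OF perm] even_card_boundary[OF assms(1)] by auto
  have sd: "sym_diff A B \<in> ?f ` ?E" if AB: "A \<in> ?f ` ?E" "B \<in> ?f ` ?E" for A B
  proof -
    obtain es fs where "es \<in> ?E" "fs \<in> ?E" "A = boundary es \<eta>s" "B = boundary fs \<eta>s"
      using AB by auto
    then have "map2 (\<noteq>) es fs \<in> ?E" "sym_diff A B = boundary (map2 (\<noteq>) es fs) \<eta>s"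
      using boundary_map2_neq[of es fs \<eta>s, OF _ _ permutes_inj[OF perm]] by simp_all
    then show ?thesis by blast
  qed
  have pair: "{x, y} \<in> ?f ` ?E" if xy: "x \<in> {1..n}" "y \<in> {1..n}" "x \<noteq> y" for x y
  proof -
    \<comment> \<open>The vertices that form a boundary pair with \<open>x\<close>, together with
      \<open>x\<close>. Adding \<open>{x, a}\<close> and \<open>{a, b}\<close> cancels
      \<open>a\<close>, so this set is cut by no pair that is a boundary.\<close>
    define U where "U = {z \<in> {1..n}. z = x \<or> {x, z} \<in> ?f ` ?E}"
    have step: "b \<in> U" if "a \<in> U" "{a, b} \<in> ?f ` ?E" for a b
    proof -
      have "b \<in> {1..n}" using that(2) \<open>?f ` ?E \<subseteq> ?W\<close> by blast
      moreover have "b = x \<or> {x, b} \<in> ?f ` ?E"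
      proof (cases "b = x \<or> a = x \<or> a = b")
        case True
        then show ?thesis using that by (auto simp: U_def)
      next
        case False
        then have "sym_diff {x, a} {a, b} = {x, b}" by auto
        moreover have "{x, a} \<in> ?f ` ?E" using that(1) False by (simp add: U_def)
        ultimately show ?thesis using sd[OF _ that(2), of "{x, a}"] by simp
      qed
      ultimately show ?thesis by (simp add: U_def)
    qed
    have "\<eta> ` U = U" if "\<eta> \<in> set \<eta>s" for \<eta>
    proof (rule boundary_pairs_separate[OF assms(1) _ that])
      fix a b es assume "length es = length \<eta>s" "boundary es \<eta>s = {a, b}"
      then have "{a, b} \<in> ?f ` ?E" "{b, a} \<in> ?f ` ?E" by (auto simp: insert_commute intro!: image_eqI[of _ _ es])
      then show "a \<in> U \<longleftrightarrow> b \<in> U" using step by blast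
    qed
    moreover have "x \<in> U" "U \<subseteq> {1..n}" using xy by (auto simp: U_def)
    ultimately have "U = {1..n}" using assms(2) unfolding transitive_on_def by blast
    then show ?thesis using xy by (auto simp: U_def)
  qed
  show "?W \<subseteq> ?f ` ?E"
  proof
    fix W assume "W \<in> ?W"
    then show "W \<in> ?f ` ?E"
    proof (induction "card W" arbitrary: W rule: less_induct)
      case less
      then have fin: "finite W" using finite_subset by auto
      show ?case
      proof (cases "W = {}")
        case True
        then show ?thesis
          by (intro image_eqI[of _ _ "replicate (length \<eta>s) False"]) (simp_all add: boundary_replicate_False)
      next
        case False
        then obtain x where x: "x \<in> W" by blast
        have "card W \<noteq> 1" using less.prems by auto
        then have "W \<noteq> {x}" by auto
        then obtain y where y: "y \<in> W" "y \<noteq> x" using x by blast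
        have "card (W - {x, y}) = card W - 2" using x y fin by (subst card_Diff_subset) auto
        moreover have "card W > 0" using False fin by (simp add: card_gt_0_iff)
        ultimately have "W - {x, y} \<in> ?f ` ?E" using less.prems by (intro less.hyps) auto
        moreover have "{x, y} \<in> ?f ` ?E" using pair x y less.prems by blast
        ultimately have "sym_diff (W - {x, y}) {x, y} \<in> ?f ` ?E" by (rule sd)
        moreover have "sym_diff (W - {x, y}) {x, y} = W" using x y by auto
        ultimately show ?thesis by simp
      qed
    qed
  qed
qed

lemma card_even_subsets:
  assumes "n \<ge> 1"
  shows "2 * card {W. W \<subseteq> {1..n} \<and> even (card W)} = 2 ^ n"
proof -
  let ?E = "{W. W \<subseteq> {1..n} \<and> even (card W)}" and ?O = "{W. W \<subseteq> {1..n} \<and> odd (card W)}"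
  have "card ?E = card ?O"
  proof -
    have "{} \<subset> {1..n}" using assms by auto
    from card_subsupersets_even_odd[OF _ this] show ?thesis by simp
  qed
  moreover have "card (?E \<union> ?O) = card ?E + card ?O"
    by (rule card_Un_disjoint) auto
  moreover have "?E \<union> ?O = Pow {1..n}" by auto
  ultimately show ?thesis by (simp add: card_Pow)
qed

text \<open>The \<open>2 ^ n\<close> sign choices map linearly onto the even sets, which number half
  of \<open>2 ^ n\<close>, so the kernel and all fibres have two elements. The kernel is the cycle
  space of a connected graph with \<open>n\<close> vertices and \<open>n\<close> edges.\<close>

lemma card_lifts_with_boundary:
  assumes "set \<eta>s \<subseteq> transpositions_A n" "transitive_on n \<eta>s" "length \<eta>s = n" "n \<ge> 1"
    and "W \<subseteq> {1..n}" "even (card W)"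
  shows "card {es. length es = n \<and> boundary es \<eta>s = W} = 2"
proof -
  let ?E = "{es :: bool list. length es = n}"
  have inj: "inj \<eta>" if "\<eta> \<in> set \<eta>s" for \<eta>
    using assms(1) transpositions_A_permutes that permutes_inj by blast
  have *: "boundary (map2 (\<noteq>) es fs) \<eta>s = {} \<longleftrightarrow> boundary fs \<eta>s = boundary es \<eta>s"
    if "es \<in> ?E" "fs \<in> ?E" for es fs
  proof -
    have "boundary (map2 (\<noteq>) es fs) \<eta>s = sym_diff (boundary es \<eta>s) (boundary fs \<eta>s)"
      using that assms(3) inj by (intro boundary_map2_neq) auto
    then show ?thesis by blast
  qed
  note fin = finite_bool_lists[of n]
  have bij: "bij_betw (map2 (\<noteq>) es) ?E ?E" if "es \<in> ?E" for es
    using bij_betw_map2_neq that by blast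
  have im: "(\<lambda>es. boundary es \<eta>s) ` ?E = {W. W \<subseteq> {1..n} \<and> even (card W)}"
    using boundary_image[OF assms(1,2)] assms(3) by simp
  have "2 ^ n = card {W. W \<subseteq> {1..n} \<and> even (card W)} * card {es \<in> ?E. boundary es \<eta>s = {}}"
    using card_eq_image_times_kernel[where f = "\<lambda>es. boundary es \<eta>s" and z = "{}", OF fin bij *]
    unfolding im card_bool_lists by simp
  then have "card {W. W \<subseteq> {1..n} \<and> even (card W)} * card {es \<in> ?E. boundary es \<eta>s = {}} =
      card {W. W \<subseteq> {1..n} \<and> even (card W)} * 2" "card {W. W \<subseteq> {1..n} \<and> even (card W)} \<noteq> 0"
    using card_even_subsets[OF assms(4)] by auto
  from mult_left_cancel[OF this(2), THEN iffD1, OF this(1)]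
  have "card {es \<in> ?E. boundary es \<eta>s = {}} = 2" .
  moreover obtain es where "es \<in> ?E" "boundary es \<eta>s = W"
  proof -
    have "W \<in> (\<lambda>es. boundary es \<eta>s) ` ?E" unfolding im using assms(5,6) by blast
    then show ?thesis using that by blast
  qed
  ultimately show ?thesis
    using card_fiber_eq_kernel[where f = "\<lambda>es. boundary es \<eta>s" and z = "{}" and x = es, OF fin bij *] by simp
qed

subsection \<open>Type B transpositions and the element gamma\<close>

lemma zero_cycle_singleton: "zero_cycle [i] = transpose i (- i)"
  by (simp add: zero_cycle_def)

lemma paired_cycle_pair: "paired_cycle [i, j] = transpose i j \<circ> transpose (- i) (- j)"
  by (simp add: paired_cycle_def)

lemma zero_cycle_eq_signed_of: "zero_cycle [i] = signed_of id {nat \<bar>i\<bar>}"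
  unfolding zero_cycle_singleton
  by (auto simp: fun_eq_iff signed_of_def transpose_def sgn_if nat_eq_iff split: if_splits)

text \<open>Only the relative sign of the entries matters, because negating both leaves the paired
  cycle unchanged.\<close>

lemma paired_cycle_eq_lift:
  assumes "\<bar>i\<bar> \<noteq> \<bar>j\<bar>" "i \<noteq> 0" "j \<noteq> 0"
  shows "paired_cycle [i, j] = lift (sgn i \<noteq> sgn j) (transpose (nat \<bar>i\<bar>) (nat \<bar>j\<bar>))"
proof
  have ne: "nat \<bar>i\<bar> \<noteq> nat \<bar>j\<bar>" using assms(1) by (simp add: eq_nat_nat_iff)
  let ?R = "lift (sgn i \<noteq> sgn j) (transpose (nat \<bar>i\<bar>) (nat \<bar>j\<bar>))"
  have sgn_eq: "sgn a * \<bar>b\<bar> * (if sgn a \<noteq> sgn b then -1 else 1) = b" if "a \<noteq> 0" for a b :: int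
    using that by (auto simp: sgn_if)
  have "i \<noteq> - i" "j \<noteq> - j" "i \<noteq> j" "i \<noteq> - j" "j \<noteq> - i" using assms by auto
  then have L: "paired_cycle [i, j] i = j" "paired_cycle [i, j] (- i) = - j"
    "paired_cycle [i, j] j = i" "paired_cycle [i, j] (- j) = - i"
    unfolding paired_cycle_pair comp_apply by (simp_all add: transpose_def)
  have "?R i = sgn i * \<bar>j\<bar> * (if sgn i \<noteq> sgn j then -1 else 1)"
    by (simp add: lift_def signed_of_def moved_transpose[OF ne])
  moreover have "?R j = sgn j * \<bar>i\<bar> * (if sgn j \<noteq> sgn i then -1 else 1)"
    by (simp add: lift_def signed_of_def moved_transpose[OF ne])
  ultimately have R: "?R i = j" "?R j = i" unfolding sgn_eq[OF assms(2)] sgn_eq[OF assms(3)] by blast+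
  then have R': "?R (- i) = - j" "?R (- j) = - i" unfolding lift_def signed_of_uminus by simp_all
  show "paired_cycle [i, j] x = ?R x" for x
  proof (cases "\<bar>x\<bar> = \<bar>i\<bar> \<or> \<bar>x\<bar> = \<bar>j\<bar>")
    case True
    then consider "x = i" | "x = - i" | "x = j" | "x = - j" by linarith
    then show ?thesis using L R R' by cases simp_all
  next
    case False
    then have x: "x \<notin> {i, - i, j, - j}" and "nat \<bar>x\<bar> \<notin> {nat \<bar>i\<bar>, nat \<bar>j\<bar>}"
      by (auto simp: eq_nat_nat_iff)
    then have "?R x = x" unfolding lift_def signed_of_def moved_transpose[OF ne]
      by (simp add: transpose_def sgn_mult_abs)
    then show ?thesis using x by (simp add: paired_cycle_pair transpose_def)
  qed
qed

lemma transpositions_B_eq: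
  "transpositions_B n = (\<lambda>i. signed_of id {i}) ` {1..n} \<union> {lift e \<eta> | e \<eta>. \<eta> \<in> transpositions_A n}"
  (is "?L = ?E \<union> ?P")
proof
  show "?L \<subseteq> ?E \<union> ?P"
  proof
    fix t assume "t \<in> ?L"
    then consider i where "t = zero_cycle [i]" "i \<in> signed_range n"
      | i j where "t = paired_cycle [i, j]" "i \<in> signed_range n" "j \<in> signed_range n" "\<bar>i\<bar> \<noteq> \<bar>j\<bar>"
      by (auto simp: transpositions_B_def)
    then show "t \<in> ?E \<union> ?P"
    proof cases
      case 1
      then show ?thesis unfolding zero_cycle_eq_signed_of signed_range_iff by blast
    next
      case 2
      then have "i \<noteq> 0" "j \<noteq> 0" by (auto simp: signed_range_def)
      moreover have "transpose (nat \<bar>i\<bar>) (nat \<bar>j\<bar>) \<in> transpositions_A n"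
        using 2(2-4) unfolding signed_range_iff transpositions_A_def mem_Collect_eq
        by (intro exI[of _ "nat \<bar>i\<bar>"] exI[of _ "nat \<bar>j\<bar>"]) (simp add: eq_nat_nat_iff)
      ultimately show ?thesis using 2 paired_cycle_eq_lift by blast
    qed
  qed
  show "?E \<union> ?P \<subseteq> ?L"
  proof
    fix t assume "t \<in> ?E \<union> ?P"
    then consider i where "t = signed_of id {i}" "i \<in> {1..n}"
      | e a b where "t = lift e (transpose a b)" "a \<in> {1..n}" "b \<in> {1..n}" "a \<noteq> b"
      by (auto simp: transpositions_A_def)
    then show "t \<in> ?L"
    proof cases
      case 1
      then have "t = zero_cycle [int i]" "int i \<in> signed_range n"
        by (simp_all add: zero_cycle_eq_signed_of signed_range_def)
      then show ?thesis unfolding transpositions_B_def by blast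
    next
      case 2
      let ?j = "if e then - int b else int b"
      have "t = paired_cycle [int a, ?j]"
        using 2 by (subst paired_cycle_eq_lift) (auto simp: sgn_if)
      moreover have "int a \<in> signed_range n" "?j \<in> signed_range n" "\<bar>int a\<bar> \<noteq> \<bar>?j\<bar>"
        using 2 by (auto simp: signed_range_def)
      ultimately show ?thesis unfolding transpositions_B_def by blast
    qed
  qed
qed

lemma zero_cycle_upto:
  assumes "1 \<le> a" "a \<le> b"
  shows "zero_cycle [a..b] x =
    (if a \<le> \<bar>x\<bar> \<and> \<bar>x\<bar> \<le> b then if \<bar>x\<bar> = b then - sgn x * a else x + sgn x else x)"
proof -
  define m where "m = nat (b - a + 1)"
  \<comment> \<open>Positions \<open>0\<close> to \<open>m - 1\<close> hold the positive entries,
    positions \<open>m\<close> to \<open>2 * m - 1\<close> their negatives; the last position of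
    either half leads to the first of the other.\<close>
  let ?cs = "[a..b] @ map uminus [a..b]"
  have len: "length ?cs = 2 * m" and m: "m > 0" "length [a..b] = m" using assms by (auto simp: m_def)
  have pos: "?cs ! k = a + int k" if "k < m" for k
    using that by (auto simp: nth_append m_def nth_upto)
  have neg: "?cs ! (m + k) = - (a + int k)" if "k < m" for k
    using that by (auto simp: nth_append m_def nth_upto)
  have dist: "distinct ?cs" using assms by (auto simp: distinct_map)
  note step = cycle_of_list_nth[OF dist, unfolded len]
  have x: "x = sgn x * \<bar>x\<bar>" by (simp add: sgn_mult_abs)
  show ?thesis
  proof (cases "a \<le> \<bar>x\<bar> \<and> \<bar>x\<bar> \<le> b")
    case False
    then have "x \<notin> set ?cs" using assms by auto
    then show ?thesis using False unfolding zero_cycle_def by (subst id_outside_supp) auto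
  next
    case True
    define k where "k = nat (\<bar>x\<bar> - a)"
    have k: "k < m" "\<bar>x\<bar> = a + int k" "\<bar>x\<bar> = b \<longleftrightarrow> Suc k = m" using True by (auto simp: k_def m_def)
    show ?thesis
    proof (cases "x > 0")
      case xp: True
      then have "zero_cycle [a..b] x = ?cs ! (Suc k mod (2 * m))"
        using step[of k] pos[OF k(1)] k unfolding zero_cycle_def by auto
      moreover have "?cs ! (Suc k mod (2 * m)) = (if \<bar>x\<bar> = b then - a else x + 1)"
        using k xp pos[of "Suc k"] neg[of 0] m by (cases "Suc k = m") auto
      ultimately show ?thesis using True xp by simp
    next
      case xn: False
      then have "x < 0" using True assms by auto
      then have "x = - (a + int k)" using k(2) by simp
      then have "?cs ! (m + k) = x" using neg[OF k(1)] by simp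
      moreover have "m + k < 2 * m" using k(1) by simp
      ultimately have "zero_cycle [a..b] x = ?cs ! (Suc (m + k) mod (2 * m))"
        using step[of "m + k"] unfolding zero_cycle_def by argo
      moreover have "?cs ! (Suc (m + k) mod (2 * m)) = (if \<bar>x\<bar> = b then a else x - 1)"
      proof (cases "Suc k = m")
        case True
        then have "Suc (m + k) = 2 * m" by simp
        then have "Suc (m + k) mod (2 * m) = 0" by (metis mod_self)
        then show ?thesis using pos[of 0] m k(3) True by simp
      next
        case False
        then have "Suc (m + k) mod (2 * m) = m + Suc k" using k(1) by simp
        then show ?thesis using neg[of "Suc k"] k False \<open>x < 0\<close> by simp
      qed
      ultimately show ?thesis using True \<open>x < 0\<close> by simp
    qed
  qed
qed

text \<open>Among positive points only \<open>p\<close> and \<open>p + q\<close> have negative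
  images, namely \<open>-1\<close> and \<open>-(p + 1)\<close>. Sign sets record images, hence
  \<open>{1, p + 1}\<close>.\<close>

lemma gamma_eq:
  assumes "p \<ge> 1" "q \<ge> 1"
  shows "gamma p q = signed_of (alpha p q) {1, p + 1}"
proof
  have z2: "zero_cycle [int p + 1..int p + int q] x =
    (if int p + 1 \<le> \<bar>x\<bar> \<and> \<bar>x\<bar> \<le> int p + int q then if \<bar>x\<bar> = int p + int q then - sgn x * (int p + 1) else x + sgn x else x)" for x
    using assms by (intro zero_cycle_upto) auto
  have z1: "zero_cycle [1..int p] x =
    (if 1 \<le> \<bar>x\<bar> \<and> \<bar>x\<bar> \<le> int p then if \<bar>x\<bar> = int p then - sgn x * 1 else x + sgn x else x)" for x
    using assms by (intro zero_cycle_upto) auto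
  have odd: "gamma p q (- x) = - gamma p q x" for x
  proof -
    have "zero_cycle [int p + 1..int p + int q] (- x) = - zero_cycle [int p + 1..int p + int q] x"
      unfolding z2 by (simp add: sgn_minus)
    moreover have "zero_cycle [1..int p] (- y) = - zero_cycle [1..int p] y" for y
      unfolding z1 by (simp add: sgn_minus)
    ultimately show ?thesis unfolding gamma_def comp_apply by simp
  qed
  have pos: "gamma p q (int m) = signed_of (alpha p q) {1, p + 1} (int m)" for m
  proof -
    consider "m = 0" | "1 \<le> m" "m < p" | "m = p" "m \<ge> 1" | "p < m" "m < p + q" | "m = p + q" "m > p" | "p + q < m"
      using assms by linarith
    then show ?thesis
      by cases (use assms in \<open>simp_all add: gamma_def z1 z2 signed_of_def alpha_apply\<close>)
  qed
  show "gamma p q x = signed_of (alpha p q) {1, p + 1} x" for x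
  proof (cases "x \<ge> 0")
    case True
    then show ?thesis using pos[of "nat x"] by simp
  next
    case False
    then show ?thesis using pos[of "nat (- x)"] odd[of x] signed_of_uminus[of _ _ x] by simp
  qed
qed

subsection \<open>Absolute length\<close>

text \<open>A reflection fixes a hyperplane, so a single equation \<open>d u = d v\<close> makes an
  odd function invariant. Working modulo 3 gives finitely many functions while 2 stays invertible,
  so that \<open>d = - d\<close> still forces \<open>d = 0\<close>.\<close>

lemma transposition_B_fixes_functional:
  assumes "t \<in> transpositions_B n"
  shows "\<exists>u v. \<forall>d :: int \<Rightarrow> int. (\<forall>x. d (- x) = - d x) \<longrightarrow> 3 dvd d u - d v \<longrightarrow> (\<forall>x. 3 dvd d (t x) - d x)"
proof -
  have swap: "3 dvd d (transpose a b x) - d x" if "3 dvd d a - d b" for d :: "int \<Rightarrow> int" and a b x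
    using that dvd_minus_iff[of 3 "d a - d b"] by (auto simp: transpose_def)
  consider i where "t = zero_cycle [i]" | i j where "t = paired_cycle [i, j]"
    using assms by (auto simp: transpositions_B_def)
  then show ?thesis
  proof cases
    case 1
    then show ?thesis using swap unfolding zero_cycle_singleton by blast
  next
    case 2
    have "3 dvd d (t x) - d x" if d: "\<forall>x. d (- x) = - d x" "3 dvd d i - d j" for d :: "int \<Rightarrow> int" and x
    proof -
      have "3 dvd d (- i) - d (- j)" using d dvd_minus_iff[of 3 "d i - d j"] by simp
      from dvd_add[OF swap[of d i j "transpose (- i) (- j) x", OF d(2)]
          swap[of d "- i" "- j" x, OF this]] show ?thesis
        unfolding 2 paired_cycle_pair by simp
    qed
    then show ?thesis by blast
  qed
qed

text \<open>If \<open>k < n\<close> reflections had product \<open>gamma p q\<close>, a nonzero odd function modulo 3 would be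
  invariant under all of them (pigeonhole), hence under \<open>gamma p q\<close>; but along a zero cycle an
  invariant odd function satisfies \<open>d = - d\<close>.\<close>

lemma gamma_word_length:
  assumes "p \<ge> 1" "q \<ge> 1" "set ts \<subseteq> transpositions_B (p + q)" "perm_prod ts = gamma p q"
  shows "p + q \<le> length ts"
proof (rule ccontr)
  define n where "n = p + q"
  define k where "k = length ts"
  assume "\<not> p + q \<le> length ts"
  then have kn: "k < n" by (simp add: n_def k_def)
  have "\<forall>t\<in>set ts. \<exists>w. \<forall>d :: int \<Rightarrow> int. (\<forall>x. d (- x) = - d x) \<longrightarrow> 3 dvd d (fst w) - d (snd w) \<longrightarrow> (\<forall>x. 3 dvd d (t x) - d x)"
    using transposition_B_fixes_functional assms(3) by (auto simp: subset_iff)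
  then obtain w where w: "\<And>t d x. t \<in> set ts \<Longrightarrow> (\<forall>x. d (- x) = - d x) \<Longrightarrow>
      3 dvd d (fst (w t)) - d (snd (w t)) \<Longrightarrow> 3 dvd d (t x) - (d x :: int)"
    by (metis (no_types, lifting) bchoice)
  \<comment> \<open>The odd extension to all integers of a function on positive indices.\<close>
  define hat :: "(nat \<Rightarrow> int) \<Rightarrow> int \<Rightarrow> int" where "hat g x = sgn x * g (nat \<bar>x\<bar>)" for g x
  define A :: "(nat \<Rightarrow> int) set" where "A = {1..n} \<rightarrow>\<^sub>E {0..<3}"
  \<comment> \<open>One equation per letter: \<open>h\<close> takes at most \<open>3 ^ k\<close>
    values on the \<open>3 ^ n\<close> functions in \<open>A\<close>, so two functions collide and
    their difference satisfies all the equations.\<close>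
  define h where "h g = map (\<lambda>t. (hat g (fst (w t)) - hat g (snd (w t))) mod 3) ts" for g
  have "h ` A \<subseteq> {xs. set xs \<subseteq> {0..<3} \<and> length xs = k}" by (auto simp: h_def k_def)
  then have "card (h ` A) \<le> card {xs. set xs \<subseteq> {0..<3 :: int} \<and> length xs = k}"
    by (rule card_mono[rotated]) (simp add: finite_lists_length_eq)
  also have "\<dots> = 3 ^ k" by (simp add: card_lists_length_eq)
  also have "\<dots> < 3 ^ n" using kn by simp
  also have "\<dots> = card A" by (simp add: A_def card_PiE)
  finally have "\<not> inj_on h A" using card_image by fastforce
  then obtain g g' where g: "g \<in> A" "g' \<in> A" "g \<noteq> g'" "h g = h g'" by (auto simp: inj_on_def)
  define d where "d x = hat g x - hat g' x" for x
  have odd: "\<forall>x. d (- x) = - d x" by (simp add: d_def hat_def sgn_minus)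
  have fixed: "3 dvd d (t x) - d x" if t: "t \<in> set ts" for t x
  proof (rule w[OF t odd])
    have "(hat g (fst (w t)) - hat g (snd (w t))) mod 3 = (hat g' (fst (w t)) - hat g' (snd (w t))) mod 3"
      using g(4) t by (simp add: h_def)
    then have "3 dvd (hat g (fst (w t)) - hat g (snd (w t))) - (hat g' (fst (w t)) - hat g' (snd (w t)))"
      by (simp add: mod_eq_dvd_iff)
    then show "3 dvd d (fst (w t)) - d (snd (w t))" by (simp add: d_def algebra_simps)
  qed
  have "3 dvd d (perm_prod us x) - d x" if "set us \<subseteq> set ts" for us x
    using that
  proof (induction us)
    case (Cons u us)
    have "3 dvd d (u (perm_prod us x)) - d (perm_prod us x)" using fixed Cons.prems by simp
    then show ?case using dvd_add[OF _ Cons.IH] Cons.prems by fastforce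
  qed simp
  then have \<gamma>: "3 dvd d (gamma p q x) - d x" for x using assms(4) by (metis order_refl)
  have step: "3 dvd d (int (x + 1)) - d (int x)" if "1 \<le> x \<and> x < p \<or> p < x \<and> x < p + q" for x
    using \<gamma>[of "int x"] that unfolding gamma_eq[OF assms(1,2)] signed_of_def alpha_apply
    by (auto split: if_splits)
  have run: "3 dvd d (int (a + j)) - d (int a)" if "1 \<le> a" "a + j \<le> p \<or> p < a \<and> a + j \<le> p + q" for a j
    using that
  proof (induction j)
    case (Suc j)
    then have "3 dvd d (int (a + j)) - d (int a)" "3 dvd d (int (a + j + 1)) - d (int (a + j))"
      using step[of "a + j"] by auto
    from dvd_add[OF this] show ?case by simp
  qed simp
  \<comment> \<open>Going once around half a zero cycle returns to \<open>- a\<close>, so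
    \<open>2 * d a\<close> is divisible by 3.\<close>
  have vanish: "3 dvd d (int a)" if "3 dvd d (int b) - d (int a)" "gamma p q (int b) = - int a" for a b
  proof -
    have "3 dvd - d (int a) - d (int b)" using \<gamma>[of "int b"] that(2) odd by simp
    from dvd_add[OF this that(1)] have "3 dvd (2 :: int) * d (int a)" by simp
    then show ?thesis by presburger
  qed
  have "gamma p q (int p) = - int 1" "gamma p q (int (p + q)) = - int (p + 1)"
    using assms(1,2) by (auto simp: gamma_eq signed_of_def alpha_apply)
  then have "3 dvd d (int 1)" "3 dvd d (int (p + 1))"
    using vanish[of p 1] vanish[of "p + q" "p + 1"] run[of 1 "p - 1"] run[of "p + 1" "q - 1"] assms(1,2)
    by auto
  then have zero: "3 dvd d (int x)" if "x \<in> {1..n}" for x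
  proof (cases "x \<le> p")
    case True
    then have "3 dvd d (int x) - d (int 1)" using run[of 1 "x - 1"] that by simp
    from dvd_add[OF this \<open>3 dvd d (int 1)\<close>] show ?thesis by simp
  next
    case False
    then have "3 dvd d (int x) - d (int (p + 1))" using run[of "p + 1" "x - (p + 1)"] that by (simp add: n_def)
    from dvd_add[OF this \<open>3 dvd d (int (p + 1))\<close>] show ?thesis by simp
  qed
  have "g x = g' x" if x: "x \<in> {1..n}" for x
  proof -
    have "3 dvd g x - g' x" using zero[OF x] x by (simp add: d_def hat_def)
    moreover have "g x \<in> {0..<3}" "g' x \<in> {0..<3}" using g(1,2) x unfolding A_def by blast+
    ultimately show ?thesis by (auto elim!: dvdE) presburger
  qed
  then have "g = g'" using g(1,2) unfolding A_def by (metis PiE_ext)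
  with g(3) show False by simp
qed

section \<open>Group laws, reduced words and the length of \<open>gamma\<close>\<close>

lemma signed_perms_bij: "\<pi> \<in> signed_perms n \<Longrightarrow> bij \<pi>"
  by (auto simp: signed_perms_def permutes_bij)

lemma signed_perms_comp: "\<pi> \<in> signed_perms n \<Longrightarrow> \<sigma> \<in> signed_perms n \<Longrightarrow> \<pi> \<circ> \<sigma> \<in> signed_perms n"
  by (auto simp: signed_perms_def intro: permutes_compose)

lemma signed_perms_id: "id \<in> signed_perms n"
  by (simp add: signed_perms_def permutes_id)

lemma signed_perms_inv:
  assumes "\<pi> \<in> signed_perms n"
  shows "inv' \<pi> \<in> signed_perms n"
proof -
  have \<pi>: "\<pi> permutes signed_range n" "\<And>x. \<pi> (- x) = - \<pi> x" using assms by (auto simp: signed_perms_def)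
  have "inv' \<pi> (- x) = - inv' \<pi> x" for x
    by (subst permutes_inv_eq[OF \<pi>(1)]) (simp add: \<pi>(2) permutes_inverses[OF \<pi>(1)])
  then show ?thesis using permutes_inv[OF \<pi>(1)] by (simp add: signed_perms_def)
qed

lemma transpositions_B_subset: "transpositions_B n \<subseteq> signed_perms n"
proof
  fix t assume "t \<in> transpositions_B n"
  then consider i where "t = signed_of id {i}" "i \<in> {1..n}"
    | e \<eta> where "t = lift e \<eta>" "\<eta> \<in> transpositions_A n"
    unfolding transpositions_B_eq by blast
  then show "t \<in> signed_perms n"
  proof cases
    case 1
    then show ?thesis by (intro signed_of_in_signed_perms[THEN subst[of _ _ "\<lambda>t. t \<in> _", rotated]]) (auto simp: permutes_id)
  next
    case 2
    from transpositions_A_permutes[OF 2(2)] show ?thesis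
      unfolding 2(1) lift_def using moved_subset by (intro signed_of_in_signed_perms) auto
  qed
qed

lemma perm_prod_signed_perms: "set ts \<subseteq> transpositions_B n \<Longrightarrow> perm_prod ts \<in> signed_perms n"
  using transpositions_B_subset
  by (induction ts) (auto simp del: comp_apply intro!: signed_perms_id signed_perms_comp)

text \<open>Lift a word for \<rho> with all signs plain, then prepend one sign change for each
  element of \<open>N\<close>. This guarantees that the minimum defining \<open>abs_length\<close>
  is attained.\<close>

lemma signed_perm_word:
  assumes "\<pi> \<in> signed_perms n"
  shows "\<exists>ts. set ts \<subseteq> transpositions_B n \<and> perm_prod ts = \<pi>"
proof -
  obtain \<rho> N where \<rho>: "\<rho> permutes {1..n}" and N: "N \<subseteq> {1..n}" and \<pi>: "\<pi> = signed_of \<rho> N"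
    using assms by (rule signed_perms_E)
  have "finite N" using N finite_subset by auto
  then show ?thesis using N unfolding \<pi>
  proof induction
    case empty
    obtain zs where zs: "set zs \<subseteq> transpositions_A n" "perm_prod zs = \<rho>"
      using permutation_word_bound[OF \<rho>] by blast
    let ?es = "replicate (length zs) False"
    have "perm_prod (map2 lift ?es zs) = signed_of \<rho> {}"
      using perm_prod_map2_lift[of ?es zs n] zs transpositions_A_permutes
      by (auto simp: boundary_replicate_False subset_iff)
    moreover have "set (map2 lift ?es zs) \<subseteq> transpositions_B n"
      using zs(1) by (auto simp: transpositions_B_eq dest!: set_zip_rightD)
    ultimately show ?case by blast
  next
    case (insert i N)
    then obtain ts where ts: "set ts \<subseteq> transpositions_B n" "perm_prod ts = signed_of \<rho> N" by blast
    have "signed_of id {i} \<circ> signed_of \<rho> N = signed_of \<rho> (insert i N)"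
      using insert.hyps by (subst signed_of_comp[OF permutes_id \<rho>]) (simp add: insert_Diff_if Un_commute)
    moreover have "signed_of id {i} \<in> transpositions_B n" using insert.prems by (auto simp: transpositions_B_eq)
    ultimately show ?case using ts by (intro exI[of _ "signed_of id {i} # ts"]) simp
  qed
qed

lemma abs_length_perm_prod_le:
  "set ts \<subseteq> transpositions_B n \<Longrightarrow> abs_length n (perm_prod ts) \<le> length ts"
  unfolding abs_length_def by (rule Least_le) blast

lemma reduced_word:
  assumes "\<pi> \<in> signed_perms n"
  obtains ts where "set ts \<subseteq> transpositions_B n" "perm_prod ts = \<pi>" "length ts = abs_length n \<pi>"
proof -
  obtain us where "set us \<subseteq> transpositions_B n" "perm_prod us = \<pi>"
    using signed_perm_word[OF assms] by blast
  then have "\<exists>k ts. length ts = k \<and> set ts \<subseteq> transpositions_B n \<and> perm_prod ts = \<pi>" by blast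
  from LeastI_ex[OF this] show ?thesis using that unfolding abs_length_def by blast
qed

lemma abs_length_id: "abs_length n id = 0"
  using abs_length_perm_prod_le[of "[]" n] by simp

lemma abs_length_eq_0: "\<pi> \<in> signed_perms n \<Longrightarrow> abs_length n \<pi> = 0 \<Longrightarrow> \<pi> = id"
  by (rule reduced_word[of \<pi> n]) auto

lemma abs_length_comp_le:
  assumes "\<pi> \<in> signed_perms n" "\<sigma> \<in> signed_perms n"
  shows "abs_length n (\<pi> \<circ> \<sigma>) \<le> abs_length n \<pi> + abs_length n \<sigma>"
proof -
  obtain ts us where "set ts \<subseteq> transpositions_B n" "perm_prod ts = \<pi>" "length ts = abs_length n \<pi>"
    "set us \<subseteq> transpositions_B n" "perm_prod us = \<sigma>" "length us = abs_length n \<sigma>"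
    using assms reduced_word by metis
  then show ?thesis using abs_length_perm_prod_le[of "ts @ us" n] by simp
qed

lemma comp_inv_comp: "bij \<pi> \<Longrightarrow> \<pi> \<circ> (inv' \<pi> \<circ> \<sigma>) = \<sigma>"
  by (simp add: fun_eq_iff bij_is_surj surj_f_inv_f)

lemma inv_comp_comp: "bij \<pi> \<Longrightarrow> inv' \<pi> \<circ> (\<pi> \<circ> \<sigma>) = \<sigma>"
  by (simp add: fun_eq_iff bij_is_inj inv_f_f)

lemma gamma_in_signed_perms:
  assumes "p \<ge> 1" "q \<ge> 1"
  shows "gamma p q \<in> signed_perms (p + q)"
  unfolding gamma_eq[OF assms] using assms by (intro signed_of_in_signed_perms alpha_permutes) auto

lemma abs_length_gamma:
  assumes "p \<ge> 1" "q \<ge> 1"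
  shows "abs_length (p + q) (gamma p q) = p + q"
proof (rule antisym)
  let ?V = "{1..p + q}"
  note \<gamma> = gamma_in_signed_perms[OF assms]
  show "p + q \<le> abs_length (p + q) (gamma p q)"
    using reduced_word[OF \<gamma>] gamma_word_length[OF assms] by metis
  obtain zs where zs: "set zs \<subseteq> transpositions_A (p + q)" "perm_prod zs = alpha p q"
    "card {U \<in> Pow ?V. alpha p q ` U = U} * 2 ^ length zs \<le> 2 ^ (p + q)"
    using permutation_word_bound[OF alpha_permutes] by blast
  let ?A = "{1..p}" and ?B = "{p + 1..p + q}"
  have img: "alpha p q ` U = U" if "\<And>x. x \<in> U \<Longrightarrow> alpha p q x \<in> U" "U \<subseteq> ?V" for U
    using that permutes_inj_on[OF alpha_permutes] by (intro endo_inj_surj) (auto intro: finite_subset)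
  have "alpha p q ` ?A = ?A" by (rule img) (auto simp: alpha_apply)
  moreover have "alpha p q ` ?B = ?B" by (rule img) (auto simp: alpha_apply)
  moreover have "alpha p q ` ?V = ?V" by (rule permutes_image[OF alpha_permutes])
  moreover have "?A \<subseteq> ?V" "?B \<subseteq> ?V" by auto
  \<comment> \<open>Four invariant sets suffice to leave at most \<open>p + q - 2\<close> letters in
    \<open>zs\<close>; the two sign changes below produce the sign set \<open>{1, p + 1}\<close> and
    bring the total to at most \<open>p + q\<close>.\<close>
  ultimately have "{{}, ?A, ?B, ?V} \<subseteq> {U \<in> Pow ?V. alpha p q ` U = U}" by blast
  then have "card {{}, ?A, ?B, ?V} \<le> card {U \<in> Pow ?V. alpha p q ` U = U}"
    by (rule card_mono[rotated]) simp
  moreover have "card {{}, ?A, ?B, ?V} = 4"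
  proof -
    have "?A \<noteq> {}" "?B \<noteq> {}" "?V \<noteq> {}" using assms by auto
    moreover have "?A \<noteq> ?B" "?A \<noteq> ?V" "?B \<noteq> ?V" using assms by (auto simp: Icc_eq_Icc)
    ultimately show ?thesis by simp
  qed
  ultimately have "4 * 2 ^ length zs \<le> (2 :: nat) ^ (p + q)"
    using zs(3) by (metis (no_types, lifting) mult_le_mono1 order_trans)
  then have "(2 :: nat) ^ (length zs + 2) \<le> 2 ^ (p + q)" by (simp add: power_add)
  then have len: "length zs + 2 \<le> p + q" by (subst (asm) power_increasing_iff) auto
  let ?ts = "signed_of id {1} # signed_of id {p + 1} # map2 lift (replicate (length zs) False) zs"
  have "perm_prod (map2 lift (replicate (length zs) False) zs) = signed_of (alpha p q) {}"
    using perm_prod_map2_lift[of "replicate (length zs) False" zs "p + q"] zs transpositions_A_permutes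
    by (auto simp: boundary_replicate_False subset_iff)
  then have "perm_prod ?ts = gamma p q"
    using assms by (simp add: gamma_eq signed_of_comp[OF permutes_id alpha_permutes] insert_Diff_if insert_commute)
  moreover have "set ?ts \<subseteq> transpositions_B (p + q)"
    using zs(1) assms by (auto simp: transpositions_B_eq dest!: set_zip_rightD)
  ultimately have "abs_length (p + q) (gamma p q) \<le> length ?ts"
    using abs_length_perm_prod_le by metis
  then show "abs_length (p + q) (gamma p q) \<le> p + q" using len by simp
qed

subsection \<open>Maximal chains as words\<close>

text \<open>The range of \<open>k\<close> includes both ends, so the identity and the full product
  belong to the chain.\<close>

definition chain_of :: "('a \<Rightarrow> 'a) list \<Rightarrow> ('a \<Rightarrow> 'a) set" where
  "chain_of ts = (\<lambda>k. perm_prod (take k ts)) ` {..length ts}"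

lemma abs_le_refl: "\<pi> \<in> signed_perms n \<Longrightarrow> abs_le n \<pi> \<pi>"
  using signed_perms_bij[of \<pi> n] by (simp add: abs_le_def abs_length_id bij_is_inj)

text \<open>Makes the absolute length a rank: the quotient of comparable elements of equal length
  has length 0.\<close>

lemma abs_le_antisym_length:
  assumes "\<pi> \<in> signed_perms n" "\<sigma> \<in> signed_perms n" "abs_le n \<pi> \<sigma>" "abs_length n \<pi> = abs_length n \<sigma>"
  shows "\<pi> = \<sigma>"
proof -
  have "inv' \<pi> \<circ> \<sigma> = id"
    using assms by (intro abs_length_eq_0[of _ n] signed_perms_comp signed_perms_inv) (auto simp: abs_le_def)
  then show ?thesis using comp_inv_comp[OF signed_perms_bij[OF assms(1)], of \<sigma>] by simp
qed

text \<open>Refines a finite chain to a saturated one. A longest element \<sigma> lies above the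
  others; a word ending at \<sigma> is continued by a reduced word of the quotient of \<tau> by
  \<sigma>, and lengths add because \<sigma> is below \<tau>.\<close>

lemma chain_in_word:
  assumes "finite C" "C \<subseteq> signed_perms n" "\<And>x y. x \<in> C \<Longrightarrow> y \<in> C \<Longrightarrow> abs_le n x y \<or> abs_le n y x"
    and "\<tau> \<in> signed_perms n" "\<And>x. x \<in> C \<Longrightarrow> abs_le n x \<tau>"
  shows "\<exists>ts. set ts \<subseteq> transpositions_B n \<and> length ts = abs_length n \<tau> \<and> perm_prod ts = \<tau> \<and> C \<subseteq> chain_of ts"
  using assms
proof (induction "card C" arbitrary: C \<tau> rule: less_induct)
  case less
  show ?case
  proof (cases "C = {}")
    case True
    then show ?thesis using reduced_word[OF less.prems(4)] by (metis empty_subsetI)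
  next
    case False
    have "Max (abs_length n ` C) \<in> abs_length n ` C" using less.prems(1) False by (intro Max_in) auto
    then obtain \<sigma> where "\<sigma> \<in> C" "abs_length n \<sigma> = Max (abs_length n ` C)" by auto
    then have \<sigma>: "\<sigma> \<in> C" "\<And>x. x \<in> C \<Longrightarrow> abs_length n x \<le> abs_length n \<sigma>"
      using less.prems(1) by auto
    have \<sigma>G: "\<sigma> \<in> signed_perms n" using \<sigma>(1) less.prems(2) by blast
    have below: "abs_le n x \<sigma>" if x: "x \<in> C" for x
    proof (cases "abs_le n x \<sigma>")
      case False
      then have *: "abs_le n \<sigma> x" using less.prems(3)[OF x \<sigma>(1)] by simp
      then have "abs_length n \<sigma> = abs_length n x" using \<sigma>(2)[OF x] by (simp add: abs_le_def)
      then show ?thesis using abs_le_antisym_length[OF \<sigma>G _ *] x less.prems(2) abs_le_refl by blast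
    qed simp
    obtain us where us: "set us \<subseteq> transpositions_B n" "length us = abs_length n \<sigma>" "perm_prod us = \<sigma>"
      "C - {\<sigma>} \<subseteq> chain_of us"
      using less.hyps[of "C - {\<sigma>}" \<sigma>] less.prems \<sigma>(1) \<sigma>G below card_Diff1_less[of C \<sigma>] by auto
    have "inv' \<sigma> \<circ> \<tau> \<in> signed_perms n" by (intro signed_perms_comp signed_perms_inv \<sigma>G less.prems(4))
    then obtain vs where vs: "set vs \<subseteq> transpositions_B n" "perm_prod vs = inv' \<sigma> \<circ> \<tau>"
      "length vs = abs_length n (inv' \<sigma> \<circ> \<tau>)" by (rule reduced_word)
    have "abs_length n \<tau> = length us + length vs"
      using less.prems(5)[OF \<sigma>(1)] us vs by (simp add: abs_le_def)
    moreover have "perm_prod (us @ vs) = \<tau>"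
      using us vs comp_inv_comp[OF signed_perms_bij[OF \<sigma>G]] by simp
    moreover have "C \<subseteq> chain_of (us @ vs)"
    proof
      fix x assume "x \<in> C"
      show "x \<in> chain_of (us @ vs)"
      proof (cases "x = \<sigma>")
        case True
        then show ?thesis unfolding chain_of_def
          using us(3) by (intro image_eqI[of _ _ "length us"]) auto
      next
        case False
        then obtain k where "k \<le> length us" "x = perm_prod (take k us)"
          using us(4) \<open>x \<in> C\<close> by (auto simp: chain_of_def)
        then show ?thesis unfolding chain_of_def by (intro image_eqI[of _ _ k]) auto
      qed
    qed
    ultimately show ?thesis using us(1) vs(1) by (intro exI[of _ "us @ vs"]) auto
  qed
qed

definition gamma_words :: "nat \<Rightarrow> nat \<Rightarrow> (int \<Rightarrow> int) list set" where
  "gamma_words p q = {ts. length ts = p + q \<and> set ts \<subseteq> transpositions_B (p + q) \<and> perm_prod ts = gamma p q}"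

text \<open>A squeeze: segments of a word are no longer than their number of letters, while the
  whole product has length exactly \<open>p + q\<close>, so the triangle inequality is an equality
  throughout.\<close>

lemma
  assumes "p \<ge> 1" "q \<ge> 1" "ts \<in> gamma_words p q" "i \<le> j" "j \<le> p + q"
  shows abs_length_take_word: "abs_length (p + q) (perm_prod (take j ts)) = j"
    and abs_le_take_word: "abs_le (p + q) (perm_prod (take i ts)) (perm_prod (take j ts))"
proof -
  let ?n = "p + q" and ?P = "\<lambda>k. perm_prod (take k ts)"
  have ts: "length ts = ?n" "set ts \<subseteq> transpositions_B ?n" "perm_prod ts = gamma p q"
    using assms(3) by (auto simp: gamma_words_def)
  have G: "?P k \<in> signed_perms ?n" for k
    using ts(2) set_take_subset by (intro perm_prod_signed_perms) fastforce
  have le: "abs_length ?n (?P k) \<le> k" if "k \<le> ?n" for k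
    using abs_length_perm_prod_le[of "take k ts" ?n] ts that set_take_subset[of k ts] by auto
  have D: "abs_length ?n (inv' (?P k) \<circ> ?P l) \<le> l - k" if "k \<le> l" "l \<le> ?n" for k l
  proof -
    have "take l ts = take k ts @ drop k (take l ts)"
      using append_take_drop_id[of k "take l ts"] that by (simp add: min_absorb1)
    then have "?P l = ?P k \<circ> perm_prod (drop k (take l ts))"
      using perm_prod_append by metis
    then have "inv' (?P k) \<circ> ?P l = perm_prod (drop k (take l ts))"
      using inv_comp_comp[OF signed_perms_bij[OF G]] by simp
    moreover have "set (drop k (take l ts)) \<subseteq> transpositions_B ?n"
      using ts(2) set_drop_subset set_take_subset by fast
    ultimately show ?thesis
      using abs_length_perm_prod_le[of "drop k (take l ts)" ?n] ts(1) that by simp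
  qed
  have sub: "abs_length ?n (?P l) \<le> abs_length ?n (?P k) + abs_length ?n (inv' (?P k) \<circ> ?P l)" for k l
    using abs_length_comp_le[OF G signed_perms_comp[OF signed_perms_inv[OF G] G], of k k l]
    by (simp add: comp_inv_comp[OF signed_perms_bij[OF G]])
  have "abs_length ?n (?P ?n) = ?n" using ts abs_length_gamma[OF assms(1,2)] by simp
  then have len: "abs_length ?n (?P k) = k" if "k \<le> ?n" for k
    using le[OF that] D[OF that order_refl] sub[of ?n k] that by linarith
  show "abs_length ?n (?P j) = j" using len assms(5) by simp
  show "abs_le ?n (?P i) (?P j)"
    unfolding abs_le_def using len[of i] len[of j] D[OF assms(4,5)] sub[of j i] assms(4,5) by linarith
qed

lemma chain_of_word_subset:
  assumes "p \<ge> 1" "q \<ge> 1" "ts \<in> gamma_words p q"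
  shows "chain_of ts \<subseteq> S_nc_B p q"
proof
  fix x assume "x \<in> chain_of ts"
  moreover have ts: "length ts = p + q" "set ts \<subseteq> transpositions_B (p + q)" "perm_prod ts = gamma p q"
    using assms(3) by (auto simp: gamma_words_def)
  ultimately obtain k where k: "k \<le> p + q" "x = perm_prod (take k ts)" by (auto simp: chain_of_def)
  have "x \<in> signed_perms (p + q)"
    unfolding k using ts(2) set_take_subset by (intro perm_prod_signed_perms) fastforce
  moreover have "abs_le (p + q) id x" using abs_le_take_word[OF assms, of 0 k] k by simp
  moreover have "abs_le (p + q) x (gamma p q)"
    using abs_le_take_word[OF assms k(1) order_refl] ts k by simp
  ultimately show "x \<in> S_nc_B p q" by (simp add: S_nc_B_def)
qed

lemma chain_iff_abs_le:
  "pred_on.chain (S_nc_B p q) (abs_less (p + q)) C \<longleftrightarrow>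
    C \<subseteq> S_nc_B p q \<and> (\<forall>x\<in>C. \<forall>y\<in>C. abs_le (p + q) x y \<or> abs_le (p + q) y x)"
proof -
  have "(abs_less (p + q))\<^sup>=\<^sup>= x y \<longleftrightarrow> abs_le (p + q) x y" if "x \<in> S_nc_B p q" for x y
    using that abs_le_refl by (auto simp: S_nc_B_def abs_less_def)
  then show ?thesis unfolding pred_on.chain_def by blast
qed

lemma chain_of_maximal:
  assumes "p \<ge> 1" "q \<ge> 1" "ts \<in> gamma_words p q"
  shows "chain_of ts \<in> maximal_chains p q"
proof -
  let ?chain = "pred_on.chain (S_nc_B p q) (abs_less (p + q))"
  have len: "length ts = p + q" using assms(3) by (simp add: gamma_words_def)
  have "abs_le (p + q) x y \<or> abs_le (p + q) y x" if xy: "x \<in> chain_of ts" "y \<in> chain_of ts" for x y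
  proof -
    obtain i j where "i \<le> p + q" "x = perm_prod (take i ts)" "j \<le> p + q" "y = perm_prod (take j ts)"
      using xy len by (auto simp: chain_of_def)
    then show ?thesis using abs_le_take_word[OF assms] by (cases i j rule: le_cases) auto
  qed
  then have "?chain (chain_of ts)"
    using chain_of_word_subset[OF assms] by (simp add: chain_iff_abs_le)
  moreover have "C \<subseteq> chain_of ts" if C: "?chain C" "chain_of ts \<subseteq> C" for C
  proof
    fix x assume x: "x \<in> C"
    have CS: "C \<subseteq> S_nc_B p q" using C(1) by (simp add: chain_iff_abs_le)
    then have xS: "x \<in> signed_perms (p + q)" "abs_le (p + q) x (gamma p q)"
      using x by (auto simp: S_nc_B_def)
    define k where "k = abs_length (p + q) x"
    have k: "k \<le> p + q"
      using xS(2) abs_length_gamma[OF assms(1,2)] by (simp add: abs_le_def k_def)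
    \<comment> \<open>An element comparable with the whole chain must equal the prefix product of
      its own length.\<close>
    define y where "y = perm_prod (take k ts)"
    have y: "y \<in> chain_of ts" using k len by (auto simp: y_def chain_of_def)
    then have yS: "y \<in> signed_perms (p + q)" using C(2) CS by (auto simp: S_nc_B_def)
    have "abs_length (p + q) y = k"
      unfolding y_def by (rule abs_length_take_word[OF assms order_refl k])
    moreover have "abs_le (p + q) x y \<or> abs_le (p + q) y x"
      using C x y by (auto simp: chain_iff_abs_le)
    ultimately have "x = y" using abs_le_antisym_length xS(1) yS by (metis k_def)
    then show "x \<in> chain_of ts" using y by simp
  qed
  ultimately show ?thesis unfolding maximal_chains_def pred_on.maxchain_def by blast
qed

lemma maximal_chain_word:
  assumes "p \<ge> 1" "q \<ge> 1" "C \<in> maximal_chains p q"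
  obtains ts where "ts \<in> gamma_words p q" "C = chain_of ts"
proof -
  let ?n = "p + q" and ?chain = "pred_on.chain (S_nc_B p q) (abs_less (p + q))"
  have C: "?chain C" "\<And>D. ?chain D \<Longrightarrow> \<not> C \<subset> D"
    using assms(3) by (auto simp: maximal_chains_def pred_on.maxchain_def)
  then have CS: "C \<subseteq> S_nc_B p q" and cmp: "\<And>x y. x \<in> C \<Longrightarrow> y \<in> C \<Longrightarrow> abs_le ?n x y \<or> abs_le ?n y x"
    by (auto simp: chain_iff_abs_le)
  have CG: "C \<subseteq> signed_perms ?n" using CS by (auto simp: S_nc_B_def)
  \<comment> \<open>Length is injective on a chain and bounded by the length of
    \<open>gamma p q\<close>.\<close>
  have "finite C"
  proof (rule finite_imageD[of "abs_length ?n"])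
    have "abs_length ?n ` C \<subseteq> {..?n}"
      using CS abs_length_gamma[OF assms(1,2)] by (auto simp: S_nc_B_def abs_le_def)
    then show "finite (abs_length ?n ` C)" by (rule finite_subset) simp
    show "inj_on (abs_length ?n) C"
      using cmp abs_le_antisym_length CG by (intro inj_onI) (metis subsetD)
  qed
  then obtain ts where ts: "set ts \<subseteq> transpositions_B ?n" "length ts = abs_length ?n (gamma p q)"
    "perm_prod ts = gamma p q" "C \<subseteq> chain_of ts"
    using chain_in_word[OF _ CG cmp gamma_in_signed_perms[OF assms(1,2)]] CS by (auto simp: S_nc_B_def)
  then have w: "ts \<in> gamma_words p q" by (simp add: gamma_words_def abs_length_gamma[OF assms(1,2)])
  have "?chain (chain_of ts)"
    using chain_of_maximal[OF assms(1,2) w] by (simp add: maximal_chains_def pred_on.maxchain_def)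
  then have "C = chain_of ts" using C(2) ts(4) by blast
  with w show ?thesis by (rule that)
qed

text \<open>The prefix product of \<open>k\<close> letters is the only element of length
  \<open>k\<close> in the chain, so the chain determines all prefixes and, by cancellation, all
  letters.\<close>

lemma inj_on_chain_of:
  assumes "p \<ge> 1" "q \<ge> 1"
  shows "inj_on chain_of (gamma_words p q)"
proof (rule inj_onI)
  fix ts us assume w: "ts \<in> gamma_words p q" "us \<in> gamma_words p q" and eq: "chain_of ts = chain_of us"
  have len: "length ts = p + q" "length us = p + q" using w by (auto simp: gamma_words_def)
  have P: "perm_prod (take k ts) = perm_prod (take k us)" if k: "k \<le> p + q" for k
  proof -
    have "perm_prod (take k ts) \<in> chain_of us" using k len eq by (auto simp: chain_of_def)
    then obtain j where j: "j \<le> p + q" "perm_prod (take k ts) = perm_prod (take j us)"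
      using len by (auto simp: chain_of_def)
    then have "k = j" using abs_length_take_word[OF assms w(1) order_refl k]
        abs_length_take_word[OF assms w(2) order_refl j(1)] by simp
    with j show ?thesis by simp
  qed
  show "ts = us"
  proof (rule nth_equalityI)
    fix k assume "k < length ts"
    then have k: "k < p + q" using len by simp
    have snoc: "perm_prod (take (Suc k) xs) = perm_prod (take k xs) \<circ> xs ! k" if "length xs = p + q" for xs :: "(int \<Rightarrow> int) list"
      using k that by (simp add: take_Suc_conv_app_nth)
    have "perm_prod (take k ts) \<in> signed_perms (p + q)"
      using w(1) set_take_subset[of k ts] by (intro perm_prod_signed_perms) (auto simp: gamma_words_def)
    note b = signed_perms_bij[OF this]
    have "perm_prod (take k ts) \<circ> ts ! k = perm_prod (take k ts) \<circ> us ! k"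
      using P[of k] P[of "Suc k"] k snoc[OF len(1)] snoc[OF len(2)] by simp
    then show "ts ! k = us ! k" using inv_comp_comp[OF b] by metis
  qed (use len in simp)
qed

subsection \<open>Connected chains\<close>

definition unsign :: "(int \<Rightarrow> int) \<Rightarrow> nat \<Rightarrow> nat" where
  "unsign \<pi> i = nat \<bar>\<pi> (int i)\<bar>"

lemma unsign_signed_of: "\<rho> permutes {1..n} \<Longrightarrow> unsign (signed_of \<rho> N) = \<rho>"
  by (simp add: unsign_def fun_eq_iff abs_signed_of)

lemma unsign_lift: "\<eta> \<in> transpositions_A n \<Longrightarrow> unsign (lift e \<eta>) = \<eta>"
  unfolding lift_def using unsign_signed_of transpositions_A_permutes by blast

lemma abs_eq_unsign:
  assumes "\<pi> \<in> signed_perms n"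
  shows "nat \<bar>\<pi> x\<bar> = unsign \<pi> (nat \<bar>x\<bar>)"
proof -
  have "\<pi> (- x) = - \<pi> x" using assms by (auto simp: signed_perms_def)
  then show ?thesis by (cases "x \<ge> 0") (simp_all add: unsign_def)
qed

lemma perm_prod_map_unsign:
  "set ts \<subseteq> transpositions_B n \<Longrightarrow> perm_prod (map unsign ts) = unsign (perm_prod ts)"
proof (induction ts)
  case (Cons t ts)
  then have "t \<in> signed_perms n" using transpositions_B_subset by auto
  from abs_eq_unsign[OF this] Cons show ?case by (simp add: unsign_def fun_eq_iff)
qed (simp add: unsign_def fun_eq_iff)

lemma perm_prod_filter_id: "perm_prod (filter (\<lambda>f. f \<noteq> id) fs) = perm_prod fs"
  by (induction fs) auto

lemma paired_cycle_apply:
  assumes "a \<in> set as" "distinct (map abs as)" "0 \<notin> set as"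
  shows "paired_cycle as a = cycle_of_list as a"
proof -
  have "a \<notin> set (map uminus as)"
  proof
    assume "a \<in> set (map uminus as)"
    then obtain b where b: "b \<in> set as" "a = - b" by auto
    moreover have "inj_on abs (set as)" using assms(2) by (simp add: distinct_map)
    ultimately have "a = b" using assms(1) by (metis abs_minus_cancel inj_onD)
    then show False using b assms(3) by simp
  qed
  then show ?thesis by (simp add: paired_cycle_def id_outside_supp)
qed

text \<open>If the first block were mapped into itself, following a connected cycle from an entry in
  that block would never reach its entries in the other one.\<close>

lemma connectivity_crosses:
  assumes "connectivity p q \<pi> \<noteq> 0"
  shows "\<exists>x\<in>signed_range p. \<pi> x \<notin> signed_range p"
proof (rule ccontr)
  assume "\<not> ?thesis"
  then have stay: "\<pi> x \<in> signed_range p" if "x \<in> signed_range p" for x using that by blast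
  have "connected_cycles p q \<pi> \<noteq> {}" using assms by (auto simp: connectivity_def)
  then obtain as where as: "set as \<subseteq> signed_range (p + q)" "distinct (map abs as)"
    "\<forall>a\<in>set as. \<pi> a = paired_cycle as a" "set as \<inter> signed_range p \<noteq> {}"
    "set as \<inter> (signed_range (p + q) - signed_range p) \<noteq> {}"
    by (auto simp: connected_cycles_def)
  let ?m = "length as"
  have "0 \<notin> set as" using as(1) by (auto simp: signed_range_def)
  then have step: "\<pi> (as ! i) = as ! (Suc i mod ?m)" if "i < ?m" for i
    using as(2,3) that paired_cycle_apply[of "as ! i" as] cycle_of_list_nth[of as i]
    by (simp add: distinct_map)
  obtain i j where ij: "i < ?m" "as ! i \<in> signed_range p" "j < ?m" "as ! j \<notin> signed_range p"
    using as(4,5) by (auto simp: in_set_conv_nth)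
  have "as ! ((i + k) mod ?m) \<in> signed_range p" for k
  proof (induction k)
    case (Suc k)
    have "(i + k) mod ?m < ?m" using ij(1) by (intro mod_less_divisor) linarith
    from stay[OF Suc] step[OF this] show ?case by (simp add: mod_Suc_eq)
  qed (use ij in simp)
  \<comment> \<open>This number of steps leads from position \<open>i\<close> to position
    \<open>j\<close> modulo the length of the cycle.\<close>
  from this[of "j + (?m - i)"] ij show False by simp
qed

lemma finite_connected_cycles: "finite (connected_cycles p q \<pi>)"
proof (rule finite_subset)
  show "connected_cycles p q \<pi> \<subseteq> paired_cycle ` {as. set as \<subseteq> signed_range (p + q) \<and> distinct as}"
    by (auto simp: connected_cycles_def distinct_map)
  show "finite \<dots>" using finite_subset_distinct[OF finite_signed_range] by simp
qed

lemma connected_chain_word: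
  assumes "p \<ge> 1" "q \<ge> 1" "ts \<in> gamma_words p q" "connectivity p q (perm_prod (take k ts)) \<noteq> 0"
  shows "map unsign ts \<in> min_trans_fact p q \<and>
    (\<exists>es. length es = p + q \<and> ts = map2 lift es (map unsign ts))"
proof -
  let ?n = "p + q" and ?\<eta>s = "filter (\<lambda>f. f \<noteq> id) (map unsign ts)"
  have ts: "length ts = ?n" "set ts \<subseteq> transpositions_B ?n" "perm_prod ts = gamma p q"
    using assms(3) by (auto simp: gamma_words_def)
  have letter: "unsign t = id \<or> unsign t \<in> transpositions_A ?n \<and> (\<exists>e. t = lift e (unsign t))"
    if "t \<in> set ts" for t
  proof -
    consider i where "t = signed_of id {i}" | e \<eta> where "t = lift e \<eta>" "\<eta> \<in> transpositions_A ?n"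
      using ts(2) \<open>t \<in> set ts\<close> unfolding transpositions_B_eq by blast
    then show ?thesis
      by cases (use unsign_signed_of[OF permutes_id] unsign_lift in auto)
  qed
  have \<eta>s: "set ?\<eta>s \<subseteq> transpositions_A ?n" using letter by auto
  have prod: "perm_prod (map unsign ts) = alpha p q"
    using perm_prod_map_unsign[OF ts(2)] ts(3) unsign_signed_of[OF alpha_permutes]
    by (simp add: gamma_eq[OF assms(1,2)])
  have prod': "perm_prod ?\<eta>s = alpha p q" using prod by (simp only: perm_prod_filter_id)
  \<comment> \<open>Without a crossing letter every prefix product would preserve the first block,
    and no element of the chain would have a connected cycle.\<close>
  have "\<exists>\<eta>\<in>set ?\<eta>s. \<eta> ` {1..p} \<noteq> {1..p}"
  proof (rule ccontr)
    assume "\<not> ?thesis"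
    then have inv: "unsign t ` {1..p} = {1..p}" if "t \<in> set ts" for t
      using that by (cases "unsign t = id") auto
    have stay: "perm_prod us x \<in> signed_range p" if "set us \<subseteq> set ts" "x \<in> signed_range p" for us x
      using that(1)
    proof (induction us)
      case (Cons u us)
      have u: "u \<in> signed_perms ?n" using Cons.prems ts(2) transpositions_B_subset by auto
      let ?y = "perm_prod us x"
      have "nat \<bar>?y\<bar> \<in> {1..p}" using Cons by (simp add: signed_range_iff)
      then have "unsign u (nat \<bar>?y\<bar>) \<in> {1..p}" using inv[of u] Cons.prems by auto
      then show ?case using abs_eq_unsign[OF u, of ?y] by (simp add: signed_range_iff)
    qed (use that in simp)
    then show False using connectivity_crosses[OF assms(4)] set_take_subset by metis
  qed
  then obtain \<eta> where \<eta>: "\<eta> \<in> set ?\<eta>s" "\<eta> ` {1..p} \<noteq> {1..p}" by blast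
  \<comment> \<open>Discarding identities leaves at least as many letters as the word has, so none
    was discarded: no letter is a sign change \<open>[i]\<close>.\<close>
  have "?n \<le> length ?\<eta>s"
    by (rule crossing_factorization_length[OF assms(1,2) \<eta>s prod' \<eta>])
  then have all: "?\<eta>s = map unsign ts"
    using ts(1) length_filter_le[of "\<lambda>f. f \<noteq> id" "map unsign ts"]
    by (metis (no_types, lifting) filter_True filter_id_conv le_antisym length_filter_less length_map order_less_irrefl)
  have "transitive_on ?n (map unsign ts)"
    using crossing_factorization_transitive[OF \<eta>s prod' \<eta>] by (simp only: all)
  then have F: "map unsign ts \<in> min_trans_fact p q"
    using \<eta>s prod ts(1) generate_eq_sym_group_iff[of "map unsign ts" ?n] unfolding all
    by (simp add: min_trans_fact_def)
  have ne: "unsign t \<noteq> id" if "t \<in> set ts" for t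
    using arg_cong[OF all, of set] that by auto
  \<comment> \<open>Every letter is one of the two lifts of its underlying transposition; the
    Boolean is \<open>True\<close> when it differs from the plain one.\<close>
  let ?es = "map (\<lambda>t. t \<noteq> lift False (unsign t)) ts"
  have "ts = map2 lift ?es (map unsign ts)"
  proof (rule nth_equalityI)
    fix i assume i: "i < length ts"
    then obtain e where "ts ! i = lift e (unsign (ts ! i))" using letter[of "ts ! i"] ne[of "ts ! i"] by auto
    then have "ts ! i = lift (ts ! i \<noteq> lift False (unsign (ts ! i))) (unsign (ts ! i))"
      by (cases "ts ! i = lift False (unsign (ts ! i))"; cases e) metis+
    then show "ts ! i = map2 lift ?es (map unsign ts) ! i" using i by simp
  qed simp
  then show ?thesis using F ts(1) by (intro conjI exI[of _ ?es]) simp_all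
qed

text \<open>If some sign pattern were not a separation pattern, the kernel of the linear map
  \<open>separations\<close> would have more than \<open>2 ^ (n - length \<eta>s)\<close> elements; they are all invariant
  under the product, which would then have a shorter factorization.\<close>

lemma shortest_word_separations:
  assumes "set \<eta>s \<subseteq> transpositions_A n" "length es = length \<eta>s"
    and short: "\<And>zs. set zs \<subseteq> transpositions_A n \<Longrightarrow> perm_prod zs = perm_prod \<eta>s \<Longrightarrow> length \<eta>s \<le> length zs"
  obtains U where "U \<subseteq> {1..n}" "separations \<eta>s U = es"
proof -
  let ?I = "separations \<eta>s ` Pow {1..n}" and ?E = "{xs :: bool list. length xs = length \<eta>s}"
  let ?K = "{U \<in> Pow {1..n}. \<forall>\<eta>\<in>set \<eta>s. \<eta> ` U = U}"
  let ?J = "{U \<in> Pow {1..n}. perm_prod \<eta>s ` U = U}"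
  have tr: "\<exists>a b. \<eta> = transpose a b" if "\<eta> \<in> set \<eta>s" for \<eta>
    using assms(1) that by (meson subsetD transpositions_A_E)
  have IE: "?I \<subseteq> ?E" by (auto simp: separations_def)
  have "es \<in> ?I"
  proof (rule ccontr)
    assume es: "es \<notin> ?I"
    have bij: "bij_betw (map2 (\<noteq>) es) ?E ?E" using assms(2) by (rule bij_betw_map2_neq)
    \<comment> \<open>The image is closed under differences and misses \<open>es\<close>, so its
      translate by \<open>es\<close> is a disjoint copy inside \<open>?E\<close>: the image fills at
      most half of \<open>?E\<close>.\<close>
    have "?I \<inter> map2 (\<noteq>) es ` ?I = {}"
    proof (rule ccontr)
      assume "\<not> ?thesis"
      then obtain U W where UW: "U \<subseteq> {1..n}" "W \<subseteq> {1..n}" "separations \<eta>s U = map2 (\<noteq>) es (separations \<eta>s W)"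
        by auto
      have "map2 (\<noteq>) (map2 (\<noteq>) xs ys) ys = xs" if "length xs = length ys" for xs ys :: "bool list"
        using that by (induction xs ys rule: list_induct2) auto
      then have "es = map2 (\<noteq>) (separations \<eta>s U) (separations \<eta>s W)"
        using UW(3) assms(2) by (simp add: separations_def)
      also have "\<dots> = separations \<eta>s (sym_diff U W)" by (rule separations_sym_diff[symmetric, OF tr])
      finally show False using es UW(1,2) by blast
    qed
    moreover have "finite ?I" by simp
    ultimately have "card (?I \<union> map2 (\<noteq>) es ` ?I) = card ?I + card (map2 (\<noteq>) es ` ?I)"
      by (intro card_Un_disjoint) auto
    also have "card (map2 (\<noteq>) es ` ?I) = card ?I"
      using bij IE by (intro card_image) (auto simp: bij_betw_def elim: inj_on_subset)
    finally have "2 * card ?I = card (?I \<union> map2 (\<noteq>) es ` ?I)" by simp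
    also have "\<dots> \<le> card ?E"
      using bij IE by (intro card_mono finite_bool_lists) (auto simp: bij_betw_def)
    finally have I: "2 * card ?I \<le> 2 ^ length \<eta>s" by (simp add: card_bool_lists)
    have "perm_prod \<eta>s permutes {1..n}"
      using assms(1) transpositions_A_permutes by (intro perm_prod_permutes) auto
    then obtain zs where zs: "set zs \<subseteq> transpositions_A n" "perm_prod zs = perm_prod \<eta>s"
      "card ?J * 2 ^ length zs \<le> 2 ^ n"
      using permutation_word_bound by blast
    have "card ?K \<le> card ?J"
    proof (rule card_mono)
      show "?K \<subseteq> ?J"
      proof
        fix U assume "U \<in> ?K"
        then show "U \<in> ?J" using perm_prod_image_invariant[of \<eta>s U] by simp
      qed
    qed simp
    then have K: "card ?K * 2 ^ length zs \<le> 2 ^ n" using zs(3) by (meson mult_le_mono1 order_trans)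
    \<comment> \<open>Combining the bounds on image and kernel shows that \<open>zs\<close> has at
      least one letter fewer than \<open>\<eta>s\<close>.\<close>
    have "2 ^ n = card ?I * card ?K" using card_separations[of "{1..n}" \<eta>s, OF _ tr] by simp
    then have "2 ^ n * (2 * 2 ^ length zs) = (2 * card ?I) * (card ?K * 2 ^ length zs)" by simp
    also have "\<dots> \<le> 2 ^ length \<eta>s * 2 ^ n" by (rule mult_le_mono[OF I K])
    finally have "(2 :: nat) ^ Suc (length zs) \<le> 2 ^ length \<eta>s" by simp
    then have "Suc (length zs) \<le> length \<eta>s" by (subst (asm) power_increasing_iff) auto
    then show False using short[OF zs(1,2)] by simp
  qed
  then show ?thesis using that by auto
qed

text \<open>The gauge argument. The set \<open>U\<close> selects one of \<open>y\<close> and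
  \<open>- y\<close> for each \<open>y\<close>: the positive one inside \<open>U\<close>, the
  negative one outside. A lift that changes signs exactly when \<open>U\<close> cuts its edge
  preserves this selection.\<close>

lemma lift_preserves_section:
  assumes "\<eta> \<in> transpositions_A n" "e \<longleftrightarrow> \<eta> ` U \<noteq> U" "nat \<bar>x\<bar> \<in> {1..n}" "x > 0 \<longleftrightarrow> nat \<bar>x\<bar> \<in> U"
  shows "lift e \<eta> x > 0 \<longleftrightarrow> nat \<bar>lift e \<eta> x\<bar> \<in> U"
proof -
  obtain a b where ab: "\<eta> = transpose a b" "a \<noteq> b" using assms(1) by (auto simp: transpositions_A_def)
  note \<eta> = transpositions_A_permutes[OF assms(1)]
  have "sgn (lift e \<eta> x) = sgn x * (if e \<and> \<eta> (nat \<bar>x\<bar>) \<in> {a, b} then -1 else 1)"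
    unfolding lift_def sgn_signed_of[OF \<eta>] using moved_transpose[OF ab(2)] ab(1) by simp
  moreover have "x \<noteq> 0" using assms(3) by auto
  ultimately have "lift e \<eta> x > 0 \<longleftrightarrow> (x > 0 \<longleftrightarrow> \<not> (e \<and> \<eta> (nat \<bar>x\<bar>) \<in> {a, b}))"
    by (cases "x > 0") (auto simp: sgn_if split: if_splits)
  moreover have "nat \<bar>lift e \<eta> x\<bar> = \<eta> (nat \<bar>x\<bar>)" unfolding lift_def by (rule abs_signed_of[OF \<eta>])
  moreover have "e \<longleftrightarrow> (a \<in> U \<longleftrightarrow> b \<notin> U)" using assms(2) unfolding ab(1) transpose_image_invariant_iff by blast
  moreover define m where "m = nat \<bar>x\<bar>"
  ultimately have "(lift e \<eta> x > 0 \<longleftrightarrow> (m \<in> U \<longleftrightarrow> \<not> (e \<and> \<eta> m \<in> {a, b})))" "nat \<bar>lift e \<eta> x\<bar> = \<eta> m"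
    "e \<longleftrightarrow> (a \<in> U \<longleftrightarrow> b \<notin> U)"
    using assms(4) by simp_all
  then show ?thesis unfolding ab(1)
    by (cases "m = a"; cases "m = b") (simp_all add: ab(2) transpose_def, blast+)
qed

lemma connected_prefix:
  assumes "p \<ge> 1" "q \<ge> 1" "\<eta>s \<in> min_trans_fact p q" "length es = p + q"
  shows "\<exists>k\<le>p + q. connectivity p q (perm_prod (take k (map2 lift es \<eta>s))) \<noteq> 0"
proof -
  let ?n = "p + q"
  have F: "length \<eta>s = ?n" "set \<eta>s \<subseteq> transpositions_A ?n" "perm_prod \<eta>s = alpha p q" "transitive_on ?n \<eta>s"
    using assms(3) generate_eq_sym_group_iff[of \<eta>s ?n] by (auto simp: min_trans_fact_def)
  have "\<exists>\<eta>\<in>set \<eta>s. \<eta> ` {1..p} \<noteq> {1..p}"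
  proof (rule ccontr)
    assume "\<not> ?thesis"
    then have "\<forall>\<eta>\<in>set \<eta>s. \<eta> ` {1..p} = {1..p}" by blast
    moreover have "{1..p} \<subseteq> {1..?n}" by simp
    ultimately have "{1..p} = {} \<or> {1..p} = {1..?n}" using F(4) unfolding transitive_on_def by blast
    then show False using assms(1,2) by (auto simp: Icc_eq_Icc)
  qed
  \<comment> \<open>Here \<open>c\<close> is the first crossing letter, and \<open>us\<close>
    preserves the first block.\<close>
  then obtain us c vs where split: "\<eta>s = us @ c # vs" "c ` {1..p} \<noteq> {1..p}" "\<forall>u\<in>set us. u ` {1..p} = {1..p}"
    using split_list_first_prop[of \<eta>s "\<lambda>\<eta>. \<eta> ` {1..p} \<noteq> {1..p}"] by blast
  define ws where "ws = us @ [c]"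
  define k where "k = length ws"
  have ws: "set ws \<subseteq> transpositions_A ?n" "\<eta>s = ws @ vs" using F(2) split(1) by (auto simp: ws_def)
  have k: "k \<le> ?n" using ws(2) F(1) by (simp add: k_def)
  have us_perm: "perm_prod us permutes {1..?n}"
    using ws(1) transpositions_A_permutes by (intro perm_prod_permutes) (auto simp: ws_def)
  have us_inv: "perm_prod us ` {1..p} = {1..p}" using split(3) by (intro perm_prod_image_invariant) auto
  have cross: "perm_prod ws ` {1..p} \<noteq> {1..p}"
  proof
    assume "perm_prod ws ` {1..p} = {1..p}"
    then have "perm_prod us ` c ` {1..p} = perm_prod us ` {1..p}"
      using us_inv by (simp add: ws_def image_comp)
    then have "c ` {1..p} = {1..p}" using inj_image_eq_iff[OF permutes_inj[OF us_perm]] by metis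
    with split(2) show False by (rule notE)
  qed
  \<comment> \<open>Any other word \<open>zs\<close> for the prefix product contains a crossing
    letter, so \<open>zs @ vs\<close> is a crossing factorization of \<open>alpha p q\<close> and
    has at least \<open>p + q\<close> letters.\<close>
  have short: "length ws \<le> length zs" if zs: "set zs \<subseteq> transpositions_A ?n" "perm_prod zs = perm_prod ws" for zs
  proof -
    obtain z where z: "z \<in> set zs" "z ` {1..p} \<noteq> {1..p}"
    proof (rule ccontr)
      assume "\<not> thesis"
      then have "perm_prod zs ` {1..p} = {1..p}" using that by (intro perm_prod_image_invariant) metis
      with cross show False unfolding zs(2) by (rule notE)
    qed
    have "?n \<le> length (zs @ vs)"
      using zs z F(2,3) ws(2) by (intro crossing_factorization_length[OF assms(1,2), of _ z]) auto
    then show ?thesis using F(1) ws(2) by simp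
  qed
  have es: "length (take k es) = length ws" using assms(4) k by (simp add: k_def)
  obtain U where U: "U \<subseteq> {1..?n}" "separations ws U = take k es"
    using shortest_word_separations[OF ws(1) es short] by blast
  \<comment> \<open>The selection given by \<open>U\<close>. It is stable under the lifted prefix
    product and never contains both \<open>y\<close> and \<open>- y\<close>, so cycles starting in
    \<open>S\<close> are paired.\<close>
  define S where "S = {x \<in> signed_range ?n. x > 0 \<longleftrightarrow> nat \<bar>x\<bar> \<in> U}"
  define \<pi> where "\<pi> = perm_prod (take k (map2 lift es \<eta>s))"
  have tk: "take k (map2 lift es \<eta>s) = map2 lift (take k es) ws"
    using ws(2) by (simp add: take_map take_zip k_def)
  have pres: "perm_prod (map2 lift (separations xs U) xs) x \<in> S"
    if "x \<in> S" "set xs \<subseteq> transpositions_A ?n" for xs x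
    using that(2)
  proof (induction xs)
    case (Cons \<eta> xs)
    let ?y = "perm_prod (map2 lift (separations xs U) xs) x"
    have y: "nat \<bar>?y\<bar> \<in> {1..?n}" "?y > 0 \<longleftrightarrow> nat \<bar>?y\<bar> \<in> U"
      using Cons by (auto simp: S_def signed_range_iff)
    have \<eta>: "\<eta> \<in> transpositions_A ?n" using Cons.prems by simp
    let ?z = "lift (\<eta> ` U \<noteq> U) \<eta> ?y"
    have "?z > 0 \<longleftrightarrow> nat \<bar>?z\<bar> \<in> U" by (rule lift_preserves_section[OF \<eta> refl y])
    moreover have "nat \<bar>?z\<bar> = \<eta> (nat \<bar>?y\<bar>)"
      unfolding lift_def by (rule abs_signed_of[OF transpositions_A_permutes[OF \<eta>]])
    then have "nat \<bar>?z\<bar> \<in> {1..?n}" using y(1) permutes_in_image[OF transpositions_A_permutes[OF \<eta>]] by simp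
    ultimately have "?z \<in> S" by (simp add: S_def signed_range_iff)
    then show ?case by (simp add: separations_def)
  qed (use that in \<open>simp add: separations_def\<close>)
  have \<pi>S: "\<pi> x \<in> S" if "x \<in> S" for x
    unfolding \<pi>_def tk U(2)[symmetric] using that ws(1) by (rule pres)
  have \<pi>_eq: "\<pi> = signed_of (perm_prod ws) (boundary (take k es) ws)"
    unfolding \<pi>_def tk using ws(1) transpositions_A_permutes by (intro perm_prod_map2_lift[OF es]) auto
  have ws_perm: "perm_prod ws permutes {1..?n}"
    using ws(1) transpositions_A_permutes by (intro perm_prod_permutes) auto
  have "\<pi> \<in> signed_perms ?n"
    unfolding \<pi>_eq using ws(1) transpositions_A_permutes
    by (intro signed_of_in_signed_perms[OF ws_perm] boundary_subset) auto
  then have \<pi>_perm: "permutation \<pi>"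
    using finite_signed_range by (auto simp: signed_perms_def permutation_permutes)
  obtain a b where ab: "c = transpose a b" "a \<in> {1..p}" "b \<in> {1..?n}" "b \<notin> {1..p}"
  proof -
    obtain a b where c: "c = transpose a b" "a \<in> {1..?n}" "b \<in> {1..?n}"
      using ws(1) by (auto simp: ws_def elim: transpositions_A_E)
    have "\<not> (a \<in> {1..p} \<longleftrightarrow> b \<in> {1..p})"
      using split(2) unfolding c(1) transpose_image_invariant_iff .
    then show ?thesis using c that[of a b] that[of b a] transpose_commute[of a b] by argo
  qed
  \<comment> \<open>The selected representative above \<open>b\<close>. The rightmost letter
    \<open>c\<close> acts first and takes \<open>b\<close> to \<open>a\<close>; then
    \<open>us\<close> keeps the point in the first block, so the cycle of \<open>x\<close> is
    connected.\<close>
  define x where "x = (if b \<in> U then int b else - int b)"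
  have xb: "nat \<bar>x\<bar> = b" by (simp add: x_def)
  have xS: "x \<in> S" using ab(3) by (auto simp: S_def signed_range_def x_def)
  define as where "as = support \<pi> x"
  have asS: "set as \<subseteq> S"
  proof -
    have "(\<pi> ^^ i) x \<in> S" for i by (induction i) (use xS \<pi>S in auto)
    then show ?thesis by (auto simp: as_def)
  qed
  have "x \<in> set as" "\<pi> x \<in> set as"
    using support_set[OF \<pi>_perm, of x] unfolding as_def
    by (auto intro: image_eqI[of _ _ 0] image_eqI[of _ _ 1] simp del: set_map)
  have inj_abs: "y = z" if "y \<in> S" "z \<in> S" "\<bar>y\<bar> = \<bar>z\<bar>" for y z
    using that by (auto simp: S_def abs_eq_iff)
  have dist: "distinct (map abs as)"
    using cycle_of_permutation[OF \<pi>_perm, of x] asS inj_abs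
    by (auto simp: distinct_map as_def[symmetric] inj_on_def)
  have as0: "0 \<notin> set as" using asS by (auto simp: S_def signed_range_def)
  have agree: "\<pi> y = paired_cycle as y" if "y \<in> set as" for y
    using cycle_restrict[OF \<pi>_perm, of y x] that paired_cycle_apply[OF that dist as0] by (simp add: as_def)
  have "nat \<bar>\<pi> x\<bar> = perm_prod us a"
    unfolding \<pi>_eq abs_signed_of[OF ws_perm] xb by (simp add: ws_def ab(1))
  also have "\<dots> \<in> {1..p}" using us_inv ab(2) by blast
  finally have "\<pi> x \<in> signed_range p" by (simp add: signed_range_iff)
  moreover have "x \<notin> signed_range p" using ab(4) xb by (simp add: signed_range_iff)
  moreover have "set as \<subseteq> signed_range ?n" using asS by (auto simp: S_def)
  ultimately have "paired_cycle as \<in> connected_cycles p q \<pi>"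
    unfolding connected_cycles_def using dist agree \<open>x \<in> set as\<close> \<open>\<pi> x \<in> set as\<close> by blast
  then have "connectivity p q \<pi> \<noteq> 0"
    using finite_connected_cycles by (auto simp: connectivity_def)
  then show ?thesis using k unfolding \<pi>_def by blast
qed

section \<open>The two connected chains above each factorization\<close>

lemma lift_in_transpositions_B: "\<eta> \<in> transpositions_A n \<Longrightarrow> lift e \<eta> \<in> transpositions_B n"
  by (auto simp: transpositions_B_eq)

lemma map_unsign_map2_lift:
  "set \<eta>s \<subseteq> transpositions_A n \<Longrightarrow> length es = length \<eta>s \<Longrightarrow> map unsign (map2 lift es \<eta>s) = \<eta>s"
  by (rule nth_equalityI) (auto intro!: unsign_lift)

lemma map2_lift_in_gamma_words_iff:
  assumes "p \<ge> 1" "q \<ge> 1" "\<eta>s \<in> min_trans_fact p q" "length es = p + q"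
  shows "map2 lift es \<eta>s \<in> gamma_words p q \<longleftrightarrow> boundary es \<eta>s = {1, p + 1}"
proof -
  have \<eta>s: "length \<eta>s = p + q" "set \<eta>s \<subseteq> transpositions_A (p + q)" "perm_prod \<eta>s = alpha p q"
    using assms(3) by (auto simp: min_trans_fact_def)
  have perm: "\<eta> permutes {1..p + q}" if "\<eta> \<in> set \<eta>s" for \<eta>
    using that \<eta>s(2) transpositions_A_permutes by blast
  have "set (map2 lift es \<eta>s) \<subseteq> transpositions_B (p + q)"
    using \<eta>s(2) by (auto intro!: lift_in_transpositions_B dest!: set_zip_rightD)
  moreover have "perm_prod (map2 lift es \<eta>s) = signed_of (alpha p q) (boundary es \<eta>s)"
    using perm_prod_map2_lift[of es \<eta>s, OF _ perm] \<eta>s assms(4) by simp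
  moreover have "signed_of (alpha p q) (boundary es \<eta>s) = gamma p q \<longleftrightarrow> boundary es \<eta>s = {1, p + 1}"
    unfolding gamma_eq[OF assms(1,2)]
    using signed_of_eq_iff[OF alpha_permutes alpha_permutes boundary_subset[OF perm],
      where M = "{1, p + 1}"] assms(1,2) by auto
  ultimately show ?thesis using assms(4) \<eta>s(1) by (simp add: gamma_words_def)
qed

text \<open>Connected chains come from lifts by \<open>connected_chain_word\<close>, lifts give
  connected chains by \<open>connected_prefix\<close>, and the boundary condition says that the
  lifted word has product \<open>gamma p q\<close>.\<close>

lemma CM_eq:
  assumes "p \<ge> 1" "q \<ge> 1"
  shows "CM p q = chain_of ` {map2 lift es \<eta>s | es \<eta>s.
    \<eta>s \<in> min_trans_fact p q \<and> length es = p + q \<and> boundary es \<eta>s = {1, p + 1}}"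
    (is "_ = chain_of ` ?W")
proof
  show "CM p q \<subseteq> chain_of ` ?W"
  proof
    fix C assume "C \<in> CM p q"
    then have C: "C \<in> maximal_chains p q" "\<not> disconnected_chain p q C" by (auto simp: CM_def)
    obtain ts where ts: "ts \<in> gamma_words p q" "C = chain_of ts"
      using maximal_chain_word[OF assms C(1)] .
    obtain k where "connectivity p q (perm_prod (take k ts)) \<noteq> 0"
      using C(2) ts(2) by (auto simp: disconnected_chain_def chain_of_def)
    from connected_chain_word[OF assms ts(1) this] obtain es where
      "map unsign ts \<in> min_trans_fact p q" "length es = p + q" "ts = map2 lift es (map unsign ts)" by blast
    then have "ts \<in> ?W" using map2_lift_in_gamma_words_iff[OF assms] ts(1) by (metis (mono_tags, lifting) mem_Collect_eq)
    then show "C \<in> chain_of ` ?W" using ts(2) by blast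
  qed
  show "chain_of ` ?W \<subseteq> CM p q"
  proof (intro image_subsetI)
    fix ts assume "ts \<in> ?W"
    then obtain es \<eta>s where *: "ts = map2 lift es \<eta>s" "\<eta>s \<in> min_trans_fact p q" "length es = p + q"
      "boundary es \<eta>s = {1, p + 1}" by blast
    then have ts: "ts \<in> gamma_words p q" using map2_lift_in_gamma_words_iff[OF assms] by simp
    then have "length ts = p + q" by (simp add: gamma_words_def)
    then have "\<not> disconnected_chain p q (chain_of ts)"
      using connected_prefix[OF assms *(2,3)] unfolding disconnected_chain_def chain_of_def *(1) by auto
    then show "chain_of ts \<in> CM p q" using chain_of_maximal[OF assms ts] by (simp add: CM_def)
  qed
qed

theorem theorem3p1:
  fixes p q :: nat
  assumes "p \<ge> 1" and "q \<ge> 1"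
  shows "\<exists>f :: (int \<Rightarrow> int) set \<Rightarrow> (nat \<Rightarrow> nat) list.
           f ` CM p q = min_trans_fact p q \<and>
           (\<forall>\<eta>s \<in> min_trans_fact p q. card {C \<in> CM p q. f C = \<eta>s} = 2)"
proof -
  let ?B = "\<lambda>\<eta>s. {es. length es = p + q \<and> boundary es \<eta>s = {1, p + 1}}"
  \<comment> \<open>Recover the word of reflections from the chain, using injectivity of
    \<open>chain_of\<close>, and forget the signs.\<close>
  define f where "f C = map unsign (inv_into (gamma_words p q) chain_of C)" for C
  have word: "map2 lift es \<eta>s \<in> gamma_words p q" if "\<eta>s \<in> min_trans_fact p q" "es \<in> ?B \<eta>s" for es \<eta>s
    using that map2_lift_in_gamma_words_iff[OF assms] by simp
  have f: "f (chain_of (map2 lift es \<eta>s)) = \<eta>s" if "\<eta>s \<in> min_trans_fact p q" "es \<in> ?B \<eta>s" for es \<eta>s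
    unfolding f_def inv_into_f_f[OF inj_on_chain_of[OF assms] word[OF that]]
    using that by (intro map_unsign_map2_lift) (auto simp: min_trans_fact_def)
  have fiber: "{C \<in> CM p q. f C = \<eta>s} = (\<lambda>es. chain_of (map2 lift es \<eta>s)) ` ?B \<eta>s"
    if "\<eta>s \<in> min_trans_fact p q" for \<eta>s
    unfolding CM_eq[OF assms] using f that by (auto simp: image_iff)
  have card: "card {C \<in> CM p q. f C = \<eta>s} = 2" if F: "\<eta>s \<in> min_trans_fact p q" for \<eta>s
  proof -
    have \<eta>s: "length \<eta>s = p + q" "set \<eta>s \<subseteq> transpositions_A (p + q)" "transitive_on (p + q) \<eta>s"
      using F generate_eq_sym_group_iff[of \<eta>s "p + q"] by (auto simp: min_trans_fact_def)
    have "inj_on (\<lambda>es. chain_of (map2 lift es \<eta>s)) (?B \<eta>s)"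
    proof (rule inj_onI)
      fix es fs assume B: "es \<in> ?B \<eta>s" "fs \<in> ?B \<eta>s"
        and "chain_of (map2 lift es \<eta>s) = chain_of (map2 lift fs \<eta>s)"
      then have eq: "map2 lift es \<eta>s = map2 lift fs \<eta>s"
        using inj_onD[OF inj_on_chain_of[OF assms]] word[OF F] by blast
      \<comment> \<open>The sign sets of the two lifts, empty and the moved pair, differ; hence a
        word determines its sign pattern and the fibre is counted by sign patterns.\<close>
      have lift_inj: "e = e'" if "lift e \<eta> = lift e' \<eta>" "\<eta> \<in> transpositions_A (p + q)" for e e' \<eta>
      proof -
        note \<eta> = transpositions_A_permutes[OF that(2)]
        have "(if e then moved \<eta> else {}) = (if e' then moved \<eta> else {})"
          using that(1) signed_of_eq_iff[OF \<eta> \<eta>] moved_subset[OF \<eta>] unfolding lift_def by simp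
        moreover have "moved \<eta> \<noteq> {}" using that(2) by (auto elim!: transpositions_A_E simp: moved_transpose)
        ultimately show ?thesis by (auto split: if_splits)
      qed
      show "es = fs"
      proof (rule nth_equalityI)
        fix i assume "i < length es"
        then have "i < p + q" using B by simp
        then have "lift (es ! i) (\<eta>s ! i) = lift (fs ! i) (\<eta>s ! i)" "\<eta>s ! i \<in> transpositions_A (p + q)"
          using arg_cong[OF eq, of "\<lambda>xs. xs ! i"] B \<eta>s by auto
        then show "es ! i = fs ! i" by (rule lift_inj)
      qed (use B in simp)
    qed
    then have "card {C \<in> CM p q. f C = \<eta>s} = card (?B \<eta>s)"
      unfolding fiber[OF F] by (rule card_image)
    also have "\<dots> = 2"
      using assms by (intro card_lifts_with_boundary[OF \<eta>s(2,3,1)]) auto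
    finally show ?thesis .
  qed
  have "f ` CM p q = min_trans_fact p q"
  proof
    show "f ` CM p q \<subseteq> min_trans_fact p q" unfolding CM_eq[OF assms] using f by auto
    show "min_trans_fact p q \<subseteq> f ` CM p q"
    proof
      fix \<eta>s assume "\<eta>s \<in> min_trans_fact p q"
      from card[OF this] have "{C \<in> CM p q. f C = \<eta>s} \<noteq> {}" by force
      then show "\<eta>s \<in> f ` CM p q" by blast
    qed
  qed
  with card show ?thesis by blast
qed

end
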